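(* Let $K$ be a finite field. Then the group $\mathrm{Aut}\,\mathbb{A}^2_K$ is linear over the field $K(t)$; that is, there is an injective group homomorphism $\mathrm{Aut}\,\mathbb{A}^2_K\to\mathrm{GL}(n,K(t))$ for some integer $n\ge 1$.
   Context: $\mathrm{Aut}\,\mathbb{A}^2_K$ is the group of polynomial automorphisms of the affine plane over $K$, i.e. pairs $(f,g)$ of (formal) polynomials in $K[x,y]$, written $(x,y)\mapsto(f,g)$, that are invertible under composition. $K(t)$ is the field of rational functions in one variable. *)

theory Defs
  imports
    "Jordan_Normal_Form.Char_Poly"
    "HOL-Computational_Algebra.Polynomial"
    "HOL-Computational_Algebra.Fraction_Field"
begin

text \<open>
  The ring \<open>K[x,y]\<close> is represented as \<open>K[x][y]\<close>, i.e. as the type \<open>'a poly poly\<close>: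
  the outer variable is \<open>y\<close>, the coefficients are polynomials in \<open>x\<close>.
\<close>

abbreviation const2 :: "'a::comm_ring_1 \<Rightarrow> 'a poly poly" where
  "const2 a \<equiv> [:[:a:]:]"

abbreviation X2 :: "'a::comm_ring_1 poly poly" where
  "X2 \<equiv> [:[:0, 1:]:]"

abbreviation Y2 :: "'a::comm_ring_1 poly poly" where
  "Y2 \<equiv> [:0, 1:]"

text \<open>\<open>subst2 (f, g) p\<close> is the polynomial \<open>p(f(x,y), g(x,y))\<close>; see \<open>subst2_altdef\<close>.\<close>

definition subst2 ::
  "'a::comm_ring_1 poly poly \<times> 'a poly poly \<Rightarrow> 'a poly poly \<Rightarrow> 'a poly poly" where
  "subst2 F p = poly (map_poly (\<lambda>c. poly (map_poly const2 c) (fst F)) p) (snd F)"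

text \<open>
  A pair \<open>(f, g)\<close> stands for the formal map \<open>(x,y) \<mapsto> (f,g)\<close>. The product \<open>F G\<close> is
  composition of maps, \<open>G\<close> being applied first.
\<close>

definition comp2 ::
  "'a::comm_ring_1 poly poly \<times> 'a poly poly \<Rightarrow> 'a poly poly \<times> 'a poly poly
    \<Rightarrow> 'a poly poly \<times> 'a poly poly" where
  "comp2 F G = (subst2 G (fst F), subst2 G (snd F))"

definition End_A2 :: "('a::comm_ring_1 poly poly \<times> 'a poly poly) monoid" where
  "End_A2 = \<lparr>carrier = UNIV, mult = comp2, one = (X2, Y2)\<rparr>"

definition Aut_A2 :: "('a::comm_ring_1 poly poly \<times> 'a poly poly) monoid" where
  "Aut_A2 = units_of End_A2"

definition GL :: "nat \<Rightarrow> 'a::field mat monoid" where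
  "GL n = units_of (ring_mat TYPE('a) n ())"

lemma map_poly_hom_aux:
  fixes h :: "'a::comm_ring_1 \<Rightarrow> 'b::comm_ring_1"
  assumes "comm_ring_hom h"
  shows "comm_ring_hom (\<lambda>p. poly (map_poly h p) u)"
proof -
  interpret h: comm_ring_hom h by fact
  interpret m: map_poly_comm_ring_hom h ..
  show ?thesis by unfold_locales (auto simp: hom_distribs)
qed

lemma const2_hom: "comm_ring_hom (const2 :: 'a::comm_ring_1 \<Rightarrow> _)"
  by unfold_locales (auto simp: one_pCons)

lemma subst2_hom: "comm_ring_hom (subst2 F)"
  unfolding subst2_def by (intro map_poly_hom_aux const2_hom)

lemma subst2_const2 [simp]: "subst2 F (const2 a) = const2 a"
proof -
  have "map_poly (\<lambda>c. poly (map_poly const2 c) u) (const2 a) = [:const2 a:]" for u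
    by (cases "a = 0") (simp_all add: map_poly_pCons)
  then show ?thesis by (simp add: subst2_def)
qed

lemma subst2_X2 [simp]: "subst2 F X2 = fst F"
  by (simp add: subst2_def map_poly_pCons one_pCons[symmetric])

lemma subst2_Y2 [simp]: "subst2 F Y2 = snd F"
  by (simp add: subst2_def map_poly_pCons one_pCons[symmetric])

lemma subst2_altdef:
  "subst2 F p = (\<Sum>j\<le>degree p. \<Sum>i\<le>degree (coeff p j).
      const2 (coeff (coeff p j) i) * fst F ^ i * snd F ^ j)"
proof -
  have *: "poly (map_poly h q) u = (\<Sum>i\<le>degree q. h (coeff q i) * u ^ i)"
    if "h 0 = 0" for h :: "'b::comm_ring_1 \<Rightarrow> 'c::comm_ring_1" and q u
  proof -
    have "(\<Sum>i\<le>degree (map_poly h q). coeff (map_poly h q) i * u ^ i)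
        = (\<Sum>i\<le>degree q. coeff (map_poly h q) i * u ^ i)"
      by (rule sum.mono_neutral_left)
        (auto simp: coeff_eq_0 not_le intro: order_trans[OF _ map_poly_degree_leq])
    then show ?thesis using that by (simp add: poly_altdef coeff_map_poly)
  qed
  show ?thesis by (simp add: subst2_def * sum_distrib_right)
qed

lemma hom2_eqI:
  fixes h k :: "'a::comm_ring_1 poly poly \<Rightarrow> 'b::comm_ring_1"
  assumes "comm_ring_hom h" "comm_ring_hom k"
    and c: "\<And>a. h (const2 a) = k (const2 a)" and x: "h X2 = k X2" and y: "h Y2 = k Y2"
  shows "h p = k p"
proof -
  interpret h: comm_ring_hom h by fact
  interpret k: comm_ring_hom k by fact
  have "h [:q:] = k [:q:]" for q
  proof (induction q)
    case (pCons a q)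
    have "[:pCons a q:] = const2 a + X2 * [:q:]" by simp
    then show ?case using pCons c x by (simp only: h.hom_add h.hom_mult k.hom_add k.hom_mult)
  qed simp
  note q = this
  show ?thesis
  proof (induction p)
    case (pCons q p)
    have "pCons q p = [:q:] + Y2 * p" by simp
    then show ?case using pCons q y by (simp only: h.hom_add h.hom_mult k.hom_add k.hom_mult)
  qed simp
qed

lemma subst2_id: "subst2 (X2, Y2) p = (p :: 'a::comm_ring_1 poly poly)"
proof (rule hom2_eqI[where k = "\<lambda>p. p"])
  show "comm_ring_hom (\<lambda>p :: 'a poly poly. p)" by unfold_locales auto
qed (auto intro: subst2_hom)

lemma subst2_subst2: "subst2 G (subst2 F p) = subst2 (comp2 F G) p"
proof (rule hom2_eqI[where h = "\<lambda>p. subst2 G (subst2 F p)" and k = "subst2 (comp2 F G)"])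
  interpret F: comm_ring_hom "subst2 F" by (rule subst2_hom)
  interpret G: comm_ring_hom "subst2 G" by (rule subst2_hom)
  show "comm_ring_hom (\<lambda>p. subst2 G (subst2 F p))"
    by unfold_locales (auto simp: F.hom_add F.hom_mult G.hom_add G.hom_mult)
qed (auto intro: subst2_hom simp: comp2_def)

lemma monoid_End_A2: "Group.monoid End_A2"
  by (rule Group.monoidI) (auto simp: End_A2_def comp2_def subst2_id subst2_subst2)

lemma group_Aut_A2: "group Aut_A2"
  unfolding Aut_A2_def by (rule Group.monoid.units_group[OF monoid_End_A2])

lemma group_GL: "group (GL n)"
  unfolding GL_def by (rule Group.monoid.units_group[OF Ring.ring.is_monoid[OF ring_mat]])

end

theory Submission
  imports Defs "HOL-Computational_Algebra.Formal_Laurent_Series"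
begin

text \<open>
  By the theorem of Jung and van der Kulk, \<open>Aut A\<^sup>2\<close> is \<open>H A\<close>, where \<open>A\<close> is the affine group, which is
  finite, and \<open>H\<close> is generated by the maps \<open>z \<mapsto> z + P(\<lambda>(z)) w\<close> with \<open>P\<close> in \<open>x\<^sup>2K[x]\<close>, \<open>\<lambda>\<close> a linear form
  and \<open>w\<close> in its kernel. Sending such a map to the matrix \<open>1 + P(t) w \<lambda>\<close> over \<open>K[t]\<close> defines an
  injective homomorphism on \<open>H\<close>: a reduced word in these generators acts non-trivially on
  \<open>K[t]\<^sup>2\<close> on either side, because each letter raises the degree. A faithful representation of a
  subgroup of finite index induces one of the whole group.

  For Jung--van der Kulk in arbitrary characteristic, let \<open>(f, g)\<close> be an automorphism with inverse
  \<open>(F, G)\<close> and let \<open>m, n > 0\<close> be the \<open>y\<close>-degrees of \<open>f\<close> and \<open>g\<close>. Give \<open>u, v\<close> the weights \<open>m, n\<close>. Since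
  \<open>F(f, g) = x\<close>, the top part of \<open>F\<close> is divisible by some \<open>u\<^sup>a - c v\<^sup>b\<close> with \<open>a : b = n : m\<close> in lowest
  terms. The pair \<open>P = f(F, G + s)\<close>, \<open>Q = g(F, G + s)\<close> satisfies \<open>F(P, Q) = F\<close>; for a suitable
  weight of \<open>s\<close>, the top parts of \<open>P\<close> and \<open>Q\<close> involve \<open>s\<close> and satisfy \<open>P\<^sup>a - c Q\<^sup>b = u\<^sup>a - c v\<^sup>b\<close>,
  which is impossible if \<open>a, b \<ge> 2\<close>. So one of the two degrees divides the other, and an
  elementary map lowers their sum.
\<close>

section \<open>Evaluation of polynomials in two variables\<close>

definition eval2 :: "('a::comm_ring_1 \<Rightarrow> 'b::comm_ring_1) \<Rightarrow> 'b \<Rightarrow> 'b \<Rightarrow> 'a poly poly \<Rightarrow> 'b" where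
  "eval2 h a b p = poly (map_poly (\<lambda>c. poly (map_poly h c) a) p) b"

lemma subst2_eval2: "subst2 F = eval2 const2 (fst F) (snd F)"
  by (rule ext) (simp add: subst2_def eval2_def)

lemma eval2_hom: "comm_ring_hom h \<Longrightarrow> comm_ring_hom (eval2 h a b)"
  unfolding eval2_def by (intro map_poly_hom_aux)

lemma comm_ring_hom_comp:
  assumes "comm_ring_hom f" "comm_ring_hom g"
  shows "comm_ring_hom (\<lambda>x. f (g x))"
proof -
  interpret f: comm_ring_hom f by fact
  interpret g: comm_ring_hom g by fact
  show ?thesis by unfold_locales (auto simp: f.hom_add f.hom_mult g.hom_add g.hom_mult)
qed

lemma eval2_simps:
  assumes "comm_ring_hom h"
  shows "eval2 h a b (const2 k) = h k" "eval2 h a b X2 = a" "eval2 h a b Y2 = b"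
proof -
  interpret comm_ring_hom h by fact
  interpret m: map_poly_comm_ring_hom h ..
  show "eval2 h a b (const2 k) = h k"
    by (cases "k = 0") (simp_all add: eval2_def map_poly_pCons)
  show "eval2 h a b X2 = a" "eval2 h a b Y2 = b"
    by (simp_all add: eval2_def map_poly_pCons)
qed

text \<open>As functions of p, both sides are homomorphisms that agree on constants, x and
  y.\<close>

lemma hom_eval2:
  assumes "comm_ring_hom h" "comm_ring_hom k"
  shows "k (eval2 h a b p) = eval2 (\<lambda>x. k (h x)) (k a) (k b) p"
  by (rule hom2_eqI[where h = "\<lambda>p. k (eval2 h a b p)"])
     (simp_all add: assms comm_ring_hom_comp eval2_hom eval2_simps)

lemma eval2_eval2:
  assumes "comm_ring_hom h"
  shows "eval2 h a b (eval2 const2 f g p) = eval2 h (eval2 h a b f) (eval2 h a b g) p"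
  by (subst hom_eval2) (simp_all add: assms const2_hom eval2_hom eval2_simps)

section \<open>Derivations and the rigidity of u^a - c v^b\<close>

definition derivation :: "('a::comm_ring_1 \<Rightarrow> 'a) \<Rightarrow> bool" where
  "derivation d \<longleftrightarrow> (\<forall>x y. d (x + y) = d x + d y) \<and> (\<forall>x y. d (x * y) = d x * y + x * d y)"

lemma derivation_0: "derivation d \<Longrightarrow> d 0 = 0"
  unfolding derivation_def by (metis add_cancel_right_right)

lemma derivation_1: "derivation d \<Longrightarrow> d 1 = 0"
  unfolding derivation_def by (metis add_cancel_right_right mult.right_neutral mult_1)

lemma derivation_diff: "derivation d \<Longrightarrow> d (x - y) = d x - d y"
  unfolding derivation_def by (metis add_diff_cancel_right' diff_add_cancel)

lemma derivation_sum: "derivation d \<Longrightarrow> d (sum f A) = (\<Sum>x\<in>A. d (f x))"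
  by (induction A rule: infinite_finite_induct) (auto simp: derivation_0, simp add: derivation_def)

lemma derivation_power:
  assumes "derivation d"
  shows "d (x ^ n) = of_nat n * x ^ (n - 1) * d x"
proof (induction n)
  case (Suc n)
  have "d (x ^ Suc n) = d x * x ^ n + x * d (x ^ n)"
    using assms by (simp add: derivation_def)
  also have "x * d (x ^ n) = of_nat n * x ^ n * d x"
  proof (cases n)
    case (Suc m)
    with Suc.IH have "d (x ^ n) = of_nat n * x ^ m * d x" by simp
    with Suc show ?thesis by (simp only:) (simp add: mult_ac)
  qed (simp add: derivation_1[OF assms])
  finally show ?case by (simp add: algebra_simps)
qed (simp add: derivation_1[OF assms])

lemma derivation_pderiv: "derivation (pderiv :: 'a::{comm_ring_1,semiring_no_zero_divisors} poly \<Rightarrow> _)"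
  unfolding derivation_def by (simp add: pderiv_add pderiv_mult mult.commute add.commute)

text \<open>Acting on coefficients treats the outer variable as a constant. Starting from
  \<open>pderiv\<close>, this yields the partial derivatives in the inner variables.\<close>

lemma derivation_map_poly:
  assumes "derivation d" shows "derivation (map_poly d)"
  unfolding derivation_def
proof safe
  note [simp] = derivation_0[OF assms]
  fix p q
  show "map_poly d (p + q) = map_poly d p + map_poly d q"
    using assms by (auto intro!: poly_eqI simp: coeff_map_poly derivation_def)
  show "map_poly d (p * q) = map_poly d p * q + p * map_poly d q"
  proof (rule poly_eqI)
    fix n
    have "coeff (map_poly d (p * q)) n = (\<Sum>i\<le>n. d (coeff p i * coeff q (n - i)))"
      by (simp add: coeff_map_poly coeff_mult derivation_sum[OF assms])
    also have "\<dots> = (\<Sum>i\<le>n. d (coeff p i) * coeff q (n - i) + coeff p i * d (coeff q (n - i)))"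
      using assms by (simp add: derivation_def)
    finally show "coeff (map_poly d (p * q)) n = coeff (map_poly d p * q + p * map_poly d q) n"
      by (simp add: coeff_map_poly coeff_mult sum.distrib)
  qed
qed

text \<open>By Bezout, 1 is an integer combination of a and b, so not both can vanish in the
  ring.\<close>

lemma coprime_of_nat_nonzero:
  assumes "coprime a b"
  shows "of_nat a \<noteq> (0 :: 'a::comm_ring_1) \<or> of_nat b \<noteq> (0 :: 'a)"
proof (rule ccontr)
  assume "\<not> ?thesis"
  then have z: "of_nat a = (0::'a)" "of_nat b = (0::'a)" by auto
  obtain x y where "x * int a + y * int b = 1"
    using assms by (metis bezout_int coprime_int_iff coprime_iff_gcd_eq_1)
  then have "of_int (x * int a + y * int b) = (1 :: 'a)" by simp
  then show False using z by simp
qed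

text \<open>Coprime numbers that are at least 2 are distinct, so one of them is at least 3.\<close>

lemma coprime_ge2: "coprime a b \<Longrightarrow> a \<ge> 2 \<Longrightarrow> b \<ge> 2 \<Longrightarrow> (a - 1) * (b - 1) \<ge> (2::nat)"
proof -
  assume "coprime a b" "a \<ge> 2" "b \<ge> 2"
  then have "a \<noteq> b" by auto
  then have "a \<ge> 3 \<or> b \<ge> 3" using \<open>a \<ge> 2\<close> \<open>b \<ge> 2\<close> by linarith
  then obtain "(a - 1 \<ge> 2 \<and> b - 1 \<ge> 1) \<or> (a - 1 \<ge> 1 \<and> b - 1 \<ge> 2)"
    using \<open>a \<ge> 2\<close> \<open>b \<ge> 2\<close> by fastforce
  then show ?thesis by (metis mult_le_mono nat_mult_1 nat_mult_1_right)
qed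

text \<open>The Jacobian determinant of \<open>(P, Q)\<close> in the two base variables specialises to 1 at \<open>s = 0\<close>.
  Solving the differentiated equation by Cramer's rule bounds the degrees of \<open>P\<close> and \<open>Q\<close> in \<open>s\<close>
  by each other.\<close>
lemma cusp_curve_rigid:
  fixes P Q :: "'a::field poly poly poly" and c :: 'a
  assumes P0: "coeff P 0 = X2" and Q0: "coeff Q 0 = Y2" and c: "c \<noteq> 0"
    and ab: "coprime a b" "a \<ge> 2" "b \<ge> 2"
    and eq: "P ^ a - [:const2 c:] * Q ^ b = [:X2 ^ a - const2 c * Y2 ^ b:]"
  shows "P = [:X2:] \<and> Q = [:Y2:]"
proof -
  \<comment> \<open>With u innermost, v in the middle and s outermost, \<open>du\<close> and
    \<open>dv\<close> are the partial derivatives in u and v, while \<open>degree\<close> counts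
    powers of s.\<close>
  define du where "du = (map_poly (map_poly pderiv) :: 'a poly poly poly \<Rightarrow> _)"
  define dv where "dv = (map_poly pderiv :: 'a poly poly poly \<Rightarrow> _)"
  have du: "derivation du" and dv: "derivation dv"
    unfolding du_def dv_def by (intro derivation_map_poly derivation_pderiv)+
  define C U V where "C = [:const2 c:]" and "U = [:X2 :: 'a poly poly:]" and "V = [:Y2 :: 'a poly poly:]"
  have C0: "C \<noteq> 0" using c by (simp add: C_def)
  have [simp]: "pderiv 0 = (0 :: 'a poly)" "pderiv 0 = (0 :: 'a poly poly)" by simp_all
  have map_const: "map_poly f [:x:] = [:f x:]" if "f 0 = 0" for f :: "'b::zero \<Rightarrow> 'b" and x
    using that by (intro poly_eqI) (simp add: coeff_map_poly coeff_pCons split: nat.splits)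
  have [simp]: "du C = 0" "dv C = 0" "du U = 1" "dv U = 0" "du V = 0" "dv V = 1"
    by (auto simp: du_def dv_def C_def U_def V_def map_const pderiv_pCons one_pCons)
  have const_power: "[:x:] ^ n = [:x ^ n:]" for x :: "'a poly poly" and n
    by (induction n) (auto simp: one_pCons)
  have eq': "P ^ a - C * Q ^ b = U ^ a - C * V ^ b"
    using eq by (simp add: C_def U_def V_def const_power)
  define A B where "A = (of_nat a :: 'a poly poly poly)" and "B = (of_nat b :: 'a poly poly poly)"
  have "du (P ^ a - C * Q ^ b) = du (U ^ a - C * V ^ b)" by (simp only: eq')
  then have e1: "A * P ^ (a - 1) * du P - C * (B * Q ^ (b - 1) * du Q) = A * U ^ (a - 1)"
    using du by (simp add: derivation_diff derivation_power A_def B_def derivation_def)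
  have "dv (P ^ a - C * Q ^ b) = dv (U ^ a - C * V ^ b)" by (simp only: eq')
  then have e2: "A * P ^ (a - 1) * dv P - C * (B * Q ^ (b - 1) * dv Q) = - C * (B * V ^ (b - 1))"
    using dv by (simp add: derivation_diff derivation_power A_def B_def derivation_def)
  have dle: "degree (du p) \<le> degree p" "degree (dv p) \<le> degree p" for p
    by (auto simp: du_def dv_def map_poly_degree_leq)
  have degU: "degree (U ^ n) = 0" "degree (V ^ n) = 0" "degree (C * p) = degree p"
     for n p using c by (auto simp: U_def V_def C_def const_power)
  have degA: "degree A = 0" "degree B = 0" by (simp_all add: A_def B_def)
  have UV0: "U \<noteq> 0" "V \<noteq> 0" by (simp_all add: U_def V_def)
  have AB: "A \<noteq> 0 \<or> B \<noteq> 0"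
    unfolding A_def B_def by (rule coprime_of_nat_nonzero) (rule ab)
  have PQ0: "P \<noteq> 0" "Q \<noteq> 0" using P0 Q0 by auto
  \<comment> \<open>Solving the equation for one of the powers shows that P and Q can only be free
    of s together.\<close>
  have degP: "degree P = 0" if "degree Q = 0"
  proof -
    have "degree (P ^ a) = degree (U ^ a - C * V ^ b + C * Q ^ b)"
      using eq' by (metis diff_eq_eq)
    also have "\<dots> \<le> 0"
      by (intro degree_add_le degree_diff_le) (simp_all add: degU degree_power_eq PQ0 that)
    finally show ?thesis using ab PQ0 by (simp add: degree_power_eq)
  qed
  have degQ: "degree Q = 0" if "degree P = 0"
  proof -
    have "C * Q ^ b = P ^ a - (U ^ a - C * V ^ b)"
      using eq' by (simp add: algebra_simps)
    moreover have "degree (P ^ a - (U ^ a - C * V ^ b)) \<le> 0"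
      by (intro degree_diff_le) (simp_all add: degU degree_power_eq PQ0 that)
    ultimately have "degree (C * Q ^ b) \<le> 0" by simp
    then show ?thesis using ab PQ0 by (simp add: degU degree_power_eq)
  qed
  have "degree P = 0 \<and> degree Q = 0"
  \<comment> \<open>When the characteristic divides a or b, one differentiated equation loses a
    term, and Q^(b-1) or P^(a-1) divides a polynomial free of s.\<close>
  proof (cases "A = 0 \<or> B = 0")
    case True
    then show ?thesis
    proof
      assume "A = 0"
      with AB e2 C0 have "Q ^ (b - 1) * dv Q = V ^ (b - 1)" by simp
      then have "Q ^ (b - 1) dvd V ^ (b - 1)" by (metis dvd_triv_left)
      then have "degree (Q ^ (b - 1)) \<le> degree (V ^ (b - 1))"
        by (rule dvd_imp_degree_le) (simp add: UV0)
      then have "degree Q = 0" using ab PQ0 by (simp add: degU degree_power_eq)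
      with degP show ?thesis by simp
    next
      assume "B = 0"
      with AB e1 have "P ^ (a - 1) * du P = U ^ (a - 1)" by simp
      then have "P ^ (a - 1) dvd U ^ (a - 1)" by (metis dvd_triv_left)
      then have "degree (P ^ (a - 1)) \<le> degree (U ^ (a - 1))"
        by (rule dvd_imp_degree_le) (simp add: UV0)
      then have "degree P = 0" using ab PQ0 by (simp add: degU degree_power_eq)
      with degQ show ?thesis by simp
    qed
  next
    case False
    have coeff_deg: "degree (A * U ^ (a - 1)) = 0" "degree (C * (B * V ^ (b - 1))) = 0"
      using False UV0 by (simp_all add: degree_mult_eq degU degA)
    have const_mult: "degree (p * q) \<le> n" if "degree p = 0" "degree q \<le> n"
      for p q :: "'a poly poly poly" and n
      using degree_mult_le[of p q] that by linarith
    define J where "J = du P * dv Q - dv P * du Q"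
    have "coeff J 0 = 1"
      by (simp add: J_def coeff_mult du_def dv_def coeff_map_poly P0 Q0 map_poly_pCons
        pderiv_pCons one_pCons)
    then have J0: "J \<noteq> 0" by auto
    \<comment> \<open>Eliminating Q^(b-1) from \<open>e1\<close> and \<open>e2\<close> leaves a
      right-hand side in which only \<open>du Q\<close> and \<open>dv Q\<close> involve s.\<close>
    have "A * (P ^ (a - 1) * J) = A * U ^ (a - 1) * dv Q + C * (B * V ^ (b - 1)) * du Q"
    proof -
      have "A * (P ^ (a - 1) * J) = (A * P ^ (a - 1) * du P - C * (B * Q ^ (b - 1) * du Q)) * dv Q
          - (A * P ^ (a - 1) * dv P - C * (B * Q ^ (b - 1) * dv Q)) * du Q"
        unfolding J_def by (simp add: algebra_simps)
      then show ?thesis unfolding e1 e2 by simp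
    qed
    then have "degree (A * (P ^ (a - 1) * J)) \<le> degree Q"
      by (simp only:) (intro degree_add_le const_mult coeff_deg dle)
    then have k: "(a - 1) * degree P \<le> degree Q"
      using False J0 PQ0 by (simp add: degree_mult_eq degree_power_eq degA mult.commute[of "degree P"])
    have "C * (B * (Q ^ (b - 1) * J)) = A * U ^ (a - 1) * dv P + C * (B * V ^ (b - 1)) * du P"
    proof -
      have "C * (B * (Q ^ (b - 1) * J)) = (A * P ^ (a - 1) * du P - C * (B * Q ^ (b - 1) * du Q)) * dv P
          - (A * P ^ (a - 1) * dv P - C * (B * Q ^ (b - 1) * dv Q)) * du P"
        unfolding J_def by (simp add: algebra_simps)
      then show ?thesis unfolding e1 e2 by simp
    qed
    then have "degree (C * (B * (Q ^ (b - 1) * J))) \<le> degree P"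
      by (simp only:) (intro degree_add_le const_mult coeff_deg dle)
    then have l: "(b - 1) * degree Q \<le> degree P"
      using False J0 PQ0 by (simp add: degree_mult_eq degree_power_eq degA degU mult.commute[of "degree Q"])
    \<comment> \<open>Both bounds combine to (a-1)(b-1) deg Q \<le> deg Q, where the factor is at
      least 2.\<close>
    have "(a - 1) * ((b - 1) * degree Q) \<le> (a - 1) * degree P"
      by (rule mult_le_mono2) (rule l)
    also note k
    also have "(a - 1) * ((b - 1) * degree Q) = (a - 1) * (b - 1) * degree Q"
      by (rule mult.assoc[symmetric])
    finally have "(a - 1) * (b - 1) * degree Q \<le> degree Q" .
    moreover have "2 * degree Q \<le> (a - 1) * (b - 1) * degree Q"
      by (rule mult_le_mono1) (rule coprime_ge2[OF ab])
    ultimately have "degree Q = 0" by linarith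
    with degP show ?thesis by simp
  qed
  then show ?thesis using P0 Q0 by (metis degree_0_id)
qed

section \<open>Weighted leading parts\<close>

text \<open>Exponents are stored as (power of x, power of y), the reverse of the nesting of the
  coefficients.\<close>

definition supp2 :: "'a::zero poly poly \<Rightarrow> (nat \<times> nat) set" where
  "supp2 F = {(i, j). coeff (coeff F j) i \<noteq> 0}"

lemma finite_supp2: "finite (supp2 F)"
proof -
  have "supp2 F \<subseteq> (\<lambda>(j, i). (i, j)) ` (SIGMA j:{..degree F}. {..degree (coeff F j)})"
  proof
    fix x assume "x \<in> supp2 F"
    then obtain i j where x: "x = (i, j)" "coeff (coeff F j) i \<noteq> 0" by (auto simp: supp2_def)
    then have "coeff F j \<noteq> 0" by auto
    with x have "j \<le> degree F" "i \<le> degree (coeff F j)" by (simp_all add: le_degree)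
    with x show "x \<in> (\<lambda>(j, i). (i, j)) ` (SIGMA j:{..degree F}. {..degree (coeff F j)})"
      by force
  qed
  then show ?thesis by (rule finite_subset) simp
qed

lemma comm_ring_hom_simps:
  assumes "comm_ring_hom h"
  shows "h (sum f A) = (\<Sum>x\<in>A. h (f x))" "h (x ^ n) = h x ^ n"
    "h (x * y) = h x * h y" "h (x + y) = h x + h y" "h (x - y) = h x - h y" "h 0 = 0" "h 1 = 1"
proof -
  interpret comm_ring_hom h by fact
  show "h (sum f A) = (\<Sum>x\<in>A. h (f x))" "h (x ^ n) = h x ^ n"
    "h (x * y) = h x * h y" "h (x + y) = h x + h y" "h (x - y) = h x - h y" "h 0 = 0" "h 1 = 1"
    by (simp_all add: hom_sum hom_power hom_mult hom_add hom_minus)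
qed

lemma poly2_sum:
  "F = (\<Sum>(i, j)\<in>supp2 F. const2 (coeff (coeff F j) i) * X2 ^ i * Y2 ^ j)"
proof -
  have "F = (\<Sum>j\<le>degree F. \<Sum>i\<le>degree (coeff F j). const2 (coeff (coeff F j) i) * X2 ^ i * Y2 ^ j)"
    using subst2_altdef[of "(X2, Y2)" F] by (simp add: subst2_id)
  also have "\<dots> = (\<Sum>(j, i)\<in>(SIGMA j:{..degree F}. {..degree (coeff F j)}).
      const2 (coeff (coeff F j) i) * X2 ^ i * Y2 ^ j)"
    by (rule sum.Sigma) auto
  also have "\<dots> = (\<Sum>(j, i)\<in>prod.swap ` supp2 F. const2 (coeff (coeff F j) i) * X2 ^ i * Y2 ^ j)"
  proof (rule sum.mono_neutral_right)
    show "prod.swap ` supp2 F \<subseteq> (SIGMA j:{..degree F}. {..degree (coeff F j)})"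
      by (auto simp: supp2_def intro!: le_degree)
    show "\<forall>i\<in>(SIGMA j:{..degree F}. {..degree (coeff F j)}) - prod.swap ` supp2 F.
       (case i of (j, i) \<Rightarrow> const2 (coeff (coeff F j) i) * X2 ^ i * Y2 ^ j) = 0"
      by (auto simp: supp2_def image_iff)
  qed auto
  also have "\<dots> = (\<Sum>(i, j)\<in>supp2 F. const2 (coeff (coeff F j) i) * X2 ^ i * Y2 ^ j)"
    by (subst sum.reindex) (auto simp: case_prod_unfold)
  finally show ?thesis .
qed

lemma eval2_sum:
  assumes "comm_ring_hom h"
  shows "eval2 h a b F = (\<Sum>(i, j)\<in>supp2 F. h (coeff (coeff F j) i) * a ^ i * b ^ j)"
proof -
  note hom = comm_ring_hom_simps[OF eval2_hom[OF assms]]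
  have "eval2 h a b F = eval2 h a b (\<Sum>(i, j)\<in>supp2 F. const2 (coeff (coeff F j) i) * X2 ^ i * Y2 ^ j)"
    using poly2_sum[of F] by simp
  then show ?thesis
    by (simp only: hom case_prod_unfold eval2_simps[OF assms])
qed

text \<open>The component of weight W when x has weight m and y has weight n. It is the leading part
  once W bounds all weights occurring in F.\<close>

definition top_part :: "nat \<Rightarrow> nat \<Rightarrow> nat \<Rightarrow> 'a::comm_ring_1 poly poly \<Rightarrow> 'a poly poly" where
  "top_part m n W F = (\<Sum>(i, j)\<in>{(i, j)\<in>supp2 F. i * m + j * n = W}.
     const2 (coeff (coeff F j) i) * X2 ^ i * Y2 ^ j)"

lemma eval2_top_part:
  assumes "comm_ring_hom h"
  shows "eval2 h a b (top_part m n W F) =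
    (\<Sum>(i, j)\<in>{(i, j)\<in>supp2 F. i * m + j * n = W}. h (coeff (coeff F j) i) * a ^ i * b ^ j)"
  by (simp only: top_part_def comm_ring_hom_simps[OF eval2_hom[OF assms]] case_prod_unfold eval2_simps[OF assms])

text \<open>Here m and n are mere upper bounds: if one of them is not attained, both sides are
  0.\<close>

lemma coeff_mult_bound:
  "degree p \<le> m \<Longrightarrow> degree q \<le> n \<Longrightarrow> coeff (p * q) (m + n) = coeff p m * (coeff q n :: 'a::comm_ring_1)"
proof (cases "degree p = m \<and> degree q = n")
  case True
  then show ?thesis by (metis coeff_mult_degree_sum)
next
  case False
  assume "degree p \<le> m" "degree q \<le> n"
  with False have "degree p < m \<or> degree q < n" "degree p + degree q < m + n" by auto
  then show ?thesis by (metis coeff_eq_0 degree_mult_le le_less_trans mult_zero_left mult_zero_right)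
qed

lemma coeff_power_bound:
  "degree p \<le> m \<Longrightarrow> coeff (p ^ k) (k * m) = coeff p m ^ k \<and> degree (p ^ k) \<le> k * m"
  for p :: "'a::comm_ring_1 poly"
proof (induction k)
  case (Suc k)
  have "degree (p * p ^ k) \<le> m + k * m"
    by (rule order_trans[OF degree_mult_le]) (use Suc in auto)
  with Suc show ?case by (simp add: coeff_mult_bound)
qed simp

text \<open>The summand with exponents (i, j) has degree at most i m + j n, so index W sees only
  monomials of weight W, and there the coefficients at m and n multiply.\<close>

lemma coeff_eval2_top:
  fixes p q :: "'b::comm_ring_1 poly"
  assumes h: "comm_ring_hom h" and p: "degree p \<le> m" and q: "degree q \<le> n"
    and W: "\<And>i j. (i, j) \<in> supp2 F \<Longrightarrow> i * m + j * n \<le> W"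
  shows "coeff (eval2 (\<lambda>c. [:h c:]) p q F) W = eval2 h (coeff p m) (coeff q n) (top_part m n W F)"
proof -
  interpret h: comm_ring_hom h by fact
  have h': "comm_ring_hom (\<lambda>c. [:h c:])"
    by unfold_locales (auto simp: h.hom_add h.hom_mult one_pCons)
  have "coeff (eval2 (\<lambda>c. [:h c:]) p q F) W =
      (\<Sum>(i, j)\<in>supp2 F. h (coeff (coeff F j) i) * coeff (p ^ i * q ^ j) W)"
    by (simp add: eval2_sum[OF h'] coeff_sum case_prod_unfold mult.assoc)
  also have "\<dots> = (\<Sum>(i, j)\<in>{(i, j)\<in>supp2 F. i * m + j * n = W}.
      h (coeff (coeff F j) i) * coeff (p ^ i * q ^ j) W)"
  proof (rule sum.mono_neutral_right[OF finite_supp2])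
    have z: "coeff (p ^ i * q ^ j) W = 0" if "(i, j) \<in> supp2 F" "i * m + j * n \<noteq> W" for i j
    proof (rule coeff_eq_0)
      have "degree (p ^ i * q ^ j) \<le> i * m + j * n"
        by (rule order_trans[OF degree_mult_le])
           (intro add_mono conjunct2[OF coeff_power_bound] p q)
      then show "degree (p ^ i * q ^ j) < W" using W[OF that(1)] that(2) by linarith
    qed
    show "\<forall>x\<in>supp2 F - {(i, j)\<in>supp2 F. i * m + j * n = W}.
       (case x of (i, j) \<Rightarrow> h (coeff (coeff F j) i) * coeff (p ^ i * q ^ j) W) = 0"
      by clarify (metis z mult_zero_right)
  qed auto
  also have "\<dots> = eval2 h (coeff p m) (coeff q n) (top_part m n W F)"
    unfolding eval2_top_part[OF h]
    by (rule sum.cong) (auto simp: coeff_mult_bound coeff_power_bound p q mult.assoc)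
  finally show ?thesis .
qed

section \<open>Leading coefficients of Laurent series\<close>

definition fls_ge :: "int \<Rightarrow> 'a::zero fls \<Rightarrow> bool" where
  "fls_ge k x \<longleftrightarrow> (\<forall>i<k. fls_nth x i = 0)"

text \<open>\<open>fls_ge\<close> admits the zero series for every bound, unlike a condition on the
  subdegree, which is 0 there by convention.\<close>

lemma fls_nth_mult_bound:
  fixes x y :: "'a::comm_ring_1 fls"
  assumes "fls_ge k x" "fls_ge l y"
  shows "fls_nth (x * y) (k + l) = fls_nth x k * fls_nth y l" "fls_ge (k + l) (x * y)"
proof -
  have *: "fls_ge (k + l) (x * y) \<and> fls_nth (x * y) (k + l) = fls_nth x k * fls_nth y l"
  proof (cases "x = 0 \<or> y = 0")
    case False
    then have k: "k \<le> fls_subdegree x" and l: "l \<le> fls_subdegree y"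
      using assms by (auto intro!: fls_subdegree_geI simp: fls_ge_def)
    show ?thesis
    proof (cases "fls_subdegree x = k \<and> fls_subdegree y = l")
      case True
      then show ?thesis by (auto simp: fls_times_nth(2) fls_ge_def fls_times_nth_eq0)
    next
      case False
      then have "k + l < fls_subdegree x + fls_subdegree y"
        "k < fls_subdegree x \<or> l < fls_subdegree y" using k l by auto
      then show ?thesis by (auto simp: fls_ge_def fls_times_nth_eq0)
    qed
  qed (auto simp: fls_ge_def)
  then show "fls_nth (x * y) (k + l) = fls_nth x k * fls_nth y l" "fls_ge (k + l) (x * y)" by auto
qed

lemma fls_nth_power_bound:
  fixes x :: "'a::comm_ring_1 fls"
  assumes "fls_ge k x"
  shows "fls_nth (x ^ e) (of_nat e * k) = fls_nth x k ^ e \<and> fls_ge (of_nat e * k) (x ^ e)"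
proof (induction e)
  case (Suc e)
  then show ?case
    using fls_nth_mult_bound[OF assms, of "of_nat e * k" "x ^ e"] by (simp add: algebra_simps)
qed (simp add: fls_ge_def)

lemma fls_const_hom: "comm_ring_hom h \<Longrightarrow> comm_ring_hom (\<lambda>c. fls_const (h c))"
proof -
  assume "comm_ring_hom h"
  then interpret h: comm_ring_hom h .
  show ?thesis
    by unfold_locales (auto simp: h.hom_add h.hom_mult fls_eq_iff)
qed

text \<open>The Laurent analogue of \<open>coeff_eval2_top\<close>, read at the lowest order. The
  factor N clears the denominator of the weight that s will receive.\<close>

lemma fls_nth_eval2_top:
  fixes p q :: "'b::comm_ring_1 fls"
  assumes h: "comm_ring_hom h" and N: "N > 0"
    and p: "fls_ge (- int (N * m)) p" and q: "fls_ge (- int (N * n)) q"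
    and W: "\<And>i j. (i, j) \<in> supp2 F \<Longrightarrow> i * m + j * n \<le> W"
  shows "fls_nth (eval2 (\<lambda>c. fls_const (h c)) p q F) (- int (N * W)) =
    eval2 h (fls_nth p (- int (N * m))) (fls_nth q (- int (N * n))) (top_part m n W F)"
proof -
  let ?k = "\<lambda>i j. of_nat i * (- int (N * m)) + of_nat j * (- int (N * n))"
  have k: "?k i j = - int (N * (i * m + j * n))" for i j by (simp add: algebra_simps)
  note hom = fls_const_hom[OF h]
  note b = fls_nth_mult_bound[OF conjunct2[OF fls_nth_power_bound[OF p]] conjunct2[OF fls_nth_power_bound[OF q]],
     unfolded k]
  have "fls_nth (eval2 (\<lambda>c. fls_const (h c)) p q F) (- int (N * W)) =
      (\<Sum>(i, j)\<in>supp2 F. h (coeff (coeff F j) i) * fls_nth (p ^ i * q ^ j) (- int (N * W)))"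
    by (simp add: eval2_sum[OF hom] fls_nth_sum case_prod_unfold mult.assoc)
  also have "\<dots> = (\<Sum>(i, j)\<in>{(i, j)\<in>supp2 F. i * m + j * n = W}.
      h (coeff (coeff F j) i) * fls_nth (p ^ i * q ^ j) (- int (N * W)))"
  proof (rule sum.mono_neutral_right[OF finite_supp2])
    have z: "fls_nth (p ^ i * q ^ j) (- int (N * W)) = 0"
      if "(i, j) \<in> supp2 F" "i * m + j * n \<noteq> W" for i j
    proof -
      have "N * (i * m + j * n) < N * W" using W[OF that(1)] that(2) N by simp
      then have "- int (N * W) < - int (N * (i * m + j * n))" by linarith
      then show ?thesis using b(2)[of i j] unfolding fls_ge_def by blast
    qed
    show "\<forall>x\<in>supp2 F - {(i, j)\<in>supp2 F. i * m + j * n = W}.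
       (case x of (i, j) \<Rightarrow> h (coeff (coeff F j) i) * fls_nth (p ^ i * q ^ j) (- int (N * W))) = 0"
      by clarify (metis z mult_zero_right)
  qed auto
  also have "\<dots> = eval2 h (fls_nth p (- int (N * m))) (fls_nth q (- int (N * n))) (top_part m n W F)"
    unfolding eval2_top_part[OF h]
  proof (rule sum.cong[OF refl], clarify)
    fix i j assume "W = i * m + j * n"
    then show "h (coeff (coeff F j) i) * fls_nth (p ^ i * q ^ j) (- int (N * (i * m + j * n))) =
       h (coeff (coeff F j) i) * fls_nth p (- int (N * m)) ^ i * fls_nth q (- int (N * n)) ^ j"
      using b(1)[of i j] fls_nth_power_bound[OF p, of i] fls_nth_power_bound[OF q, of j]
      by (simp add: mult.assoc)
  qed
  finally show ?thesis .
qed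

section \<open>Homogenisation: the form B^T C(A / B) of a polynomial C in one variable\<close>

definition homogenize :: "nat \<Rightarrow> 'a::comm_ring_1 poly \<Rightarrow> 'b \<Rightarrow> 'b \<Rightarrow> ('a \<Rightarrow> 'b) \<Rightarrow> 'b::comm_ring_1" where
  "homogenize T C A B h = (\<Sum>t\<le>T. h (coeff C t) * A ^ t * B ^ (T - t))"

lemma homogenize_pCons0:
  "h 0 = 0 \<Longrightarrow> homogenize (Suc T) (pCons 0 C) A B h = A * homogenize T C A B h"
  unfolding homogenize_def by (subst sum.atMost_Suc_shift) (simp add: sum_distrib_left algebra_simps)

lemma homogenize_Suc:
  assumes "h 0 = 0" "degree C \<le> T"
  shows "homogenize (Suc T) C A B h = B * homogenize T C A B h"
proof -
  have "coeff C (Suc T) = 0" using assms by (simp add: coeff_eq_0)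
  then show ?thesis using assms
    by (simp add: homogenize_def sum_distrib_left Suc_diff_le algebra_simps)
qed

text \<open>Homogenisation is multiplicative, and x - c becomes A - c B; the degree bound grows by
  one.\<close>

lemma homogenize_linear_factor:
  assumes "comm_ring_hom h" "degree C \<le> T"
  shows "homogenize (Suc T) ([:-c, 1:] * C) A B h = (A - h c * B) * homogenize T C A B h"
proof -
  interpret comm_ring_hom h by fact
  have "homogenize (Suc T) ([:-c, 1:] * C) A B h =
      homogenize (Suc T) (pCons 0 C) A B h - h c * homogenize (Suc T) C A B h"
  proof -
    have "coeff ([:-c, 1:] * C) t = coeff (pCons 0 C) t - c * coeff C t" for t by simp
    then show ?thesis
      by (simp only: homogenize_def hom_minus hom_mult sum_distrib_left sum_subtractf[symmetric]
        left_diff_distrib mult.assoc)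
  qed
  then show ?thesis using assms by (simp add: homogenize_pCons0 homogenize_Suc algebra_simps)
qed

lemma degree_linear_factor:
  "C \<noteq> 0 \<Longrightarrow> degree ([:-c, 1:] * C) = Suc (degree (C :: 'a::idom poly))"
  by (subst degree_mult_eq) auto

lemma dvd_homogenize:
  fixes C :: "'a::field poly"
  assumes h: "comm_ring_hom h" and C: "C \<noteq> 0" "degree C \<le> T" "poly C c = 0"
  shows "A - h c * B dvd homogenize T C A B h"
proof -
  obtain C1 where C1: "C = [:-c, 1:] * C1" using C by (auto simp: poly_eq_0_iff_dvd)
  with C have "degree C = Suc (degree C1)" by (metis degree_linear_factor mult_zero_right)
  then obtain T' where "T = Suc T'" "degree C1 \<le> T'" using C(2) by (cases T) auto
  then show ?thesis using homogenize_linear_factor[OF h, of C1 T' c A B] C1 by simp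
qed

lemma const_poly_hom: "comm_ring_hom (\<lambda>c::'a::comm_ring_1. [:c:])"
  by unfold_locales (auto simp: one_pCons)

text \<open>Factors x - c of C are removed first, each contributing the nonzero A - c B. Once c is
  no root, A = c B + R with deg R < deg B makes C(c) B^T the dominant term.\<close>

lemma homogenize_nonzero:
  fixes A B :: "'a::field poly"
  assumes "B \<noteq> 0" "A - Polynomial.smult c B \<noteq> 0" "degree (A - Polynomial.smult c B) < degree B" "C \<noteq> 0" "degree C \<le> T"
  shows "homogenize T C A B (\<lambda>c. [:c:]) \<noteq> 0"
  using assms(4,5)
proof (induction T arbitrary: C)
  case 0
  then obtain x where "C = [:x:]" "x \<noteq> 0" by (metis degree_eq_zeroE le_zero_eq pCons_0_0)
  then show ?case by (simp add: homogenize_def)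
next
  case (Suc T)
  note const_poly_hom[simp]
  define R where "R = A - Polynomial.smult c B"
  show ?case
  proof (cases "poly C c = 0")
    case True
    then obtain C1 where C1: "C = [:-c, 1:] * C1" by (auto simp: poly_eq_0_iff_dvd)
    with Suc.prems have "C1 \<noteq> 0" "degree C1 \<le> T"
      by (metis mult_zero_right, metis degree_linear_factor mult_zero_right Suc_le_mono)
    with Suc.IH have "homogenize T C1 A B (\<lambda>c. [:c:]) \<noteq> 0" by blast
    moreover have "homogenize (Suc T) C A B (\<lambda>c. [:c:]) = R * homogenize T C1 A B (\<lambda>c. [:c:])"
      unfolding C1 R_def using homogenize_linear_factor[OF const_poly_hom \<open>degree C1 \<le> T\<close>, of c A B] by simp
    ultimately show ?thesis using assms(2) by (simp add: R_def)
  next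
    case False
    let ?S = "Suc T"
    have RB: "degree R < degree B" using assms(3) by (simp add: R_def)
    have A: "A = Polynomial.smult c B + R" by (simp add: R_def)
    \<comment> \<open>The sum is the cofactor of R in A^t - (c B)^t.\<close>
    have small: "degree (\<Sum>i<t. A ^ i * Polynomial.smult c B ^ (t - Suc i)) \<le> (t - 1) * degree B" for t
    proof (rule degree_sum_le)
      fix i assume i: "i \<in> {..<t}"
      have "degree A \<le> degree B" using RB unfolding A by (intro degree_add_le) auto
      then have "degree (A ^ i) \<le> degree B * i"
        by (meson degree_power_le mult_le_mono1 order_trans)
      moreover have "degree (Polynomial.smult c B ^ (t - Suc i)) \<le> degree B * (t - Suc i)"
        by (meson degree_power_le degree_smult_le mult_le_mono1 order_trans)
      moreover have "degree B * i + degree B * (t - Suc i) = (t - 1) * degree B"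
      proof -
        have "i + (t - Suc i) = t - 1" using i by simp
        then show ?thesis by (metis distrib_left mult.commute)
      qed
      ultimately show "degree (A ^ i * Polynomial.smult c B ^ (t - Suc i)) \<le> (t - 1) * degree B"
        by (intro order_trans[OF degree_mult_le]) linarith
    qed simp
    have split: "homogenize ?S C A B (\<lambda>c. [:c:]) - Polynomial.smult (poly C c) (B ^ ?S) =
        (\<Sum>t\<le>?S. Polynomial.smult (coeff C t) ((A ^ t - Polynomial.smult c B ^ t) * B ^ (?S - t)))"
    proof -
      have "poly C c = (\<Sum>t\<le>?S. coeff C t * c ^ t)" by (rule poly_as_sum_of_monoms'[OF Suc.prems(2), THEN arg_cong, of "\<lambda>p. poly p c", symmetric, unfolded poly_sum poly_monom])
      then have "Polynomial.smult (poly C c) (B ^ ?S) = (\<Sum>t\<le>?S. Polynomial.smult (coeff C t * c ^ t) (B ^ ?S))"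
        by (simp only: smult_sum)
      also have "\<dots> = (\<Sum>t\<le>?S. Polynomial.smult (coeff C t) (Polynomial.smult c B ^ t * B ^ (?S - t)))"
        by (rule sum.cong) (auto simp: smult_power power_add[symmetric])
      finally show ?thesis
        by (simp add: homogenize_def sum_subtractf[symmetric] algebra_simps smult_diff_right)
    qed
    \<comment> \<open>In every nonzero summand R has replaced a factor of degree deg B, so the
      degree drops. As deg B > deg R, the subtraction of 1 below is not truncated.\<close>
    have "degree (\<Sum>t\<le>?S. Polynomial.smult (coeff C t) ((A ^ t - Polynomial.smult c B ^ t) * B ^ (?S - t))) < ?S * degree B"
    proof (rule le_less_trans[OF degree_sum_le])
      fix t assume t: "t \<in> {..?S}"
      show "degree (Polynomial.smult (coeff C t) ((A ^ t - Polynomial.smult c B ^ t) * B ^ (?S - t))) \<le> ?S * degree B - 1"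
      proof (cases t)
        case (Suc t')
        have "A ^ t - Polynomial.smult c B ^ t = R * (\<Sum>i<t. A ^ i * Polynomial.smult c B ^ (t - Suc i))"
          using power_diff_sumr2[of A t "Polynomial.smult c B"] unfolding R_def
          by (simp add: mult.commute[of "A ^ _"])
        then have "degree (A ^ t - Polynomial.smult c B ^ t) \<le> degree R + (t - 1) * degree B"
          using degree_mult_le[of R "\<Sum>i<t. A ^ i * Polynomial.smult c B ^ (t - Suc i)"] small[of t] by simp
        moreover have "degree (B ^ (?S - t)) \<le> degree B * (?S - t)" by (rule degree_power_le)
        moreover have "degree B * (?S - t) + (t - 1) * degree B + degree B = ?S * degree B"
        proof -
          have "?S = (?S - t) + (t - 1) + 1" using t Suc by auto
          then show ?thesis by (metis distrib_right mult.commute mult_1)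
        qed
        ultimately show ?thesis using RB
          by (intro order_trans[OF degree_smult_le] order_trans[OF degree_mult_le]) linarith
      qed simp
    qed (use RB in auto)
    moreover have "degree (Polynomial.smult (poly C c) (B ^ ?S)) = ?S * degree B"
      using False assms(1) by (simp add: degree_mult_eq degree_power_eq)
    ultimately show ?thesis unfolding split[symmetric] by auto
  qed
qed

text \<open>Reversing the T + 1 coefficients of C exchanges A and B.\<close>

lemma homogenize_reflect:
  assumes "degree C \<le> T" "C \<noteq> (0 :: 'a::comm_ring_1 poly)"
  obtains C' where "degree C' \<le> T" "C' \<noteq> 0" "\<And>A B h. homogenize T C' A B h = homogenize T C B A h"
proof
  define C' where "C' = (\<Sum>t\<le>T. monom (coeff C (T - t)) t)"
  have C': "coeff C' t = (if t \<le> T then coeff C (T - t) else 0)" for t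
    by (simp add: C'_def coeff_sum)
  show "degree C' \<le> T" by (rule degree_le) (simp add: C')
  have "coeff C' (T - degree C) \<noteq> 0" using assms by (simp add: C')
  then show "C' \<noteq> 0" by auto
  show "homogenize T C' A B h = homogenize T C B A h" for A B h
    unfolding homogenize_def by (subst sum.nat_diff_reindex[symmetric, of _ "Suc T", unfolded lessThan_Suc_atMost])
      (auto intro!: sum.cong simp: C' mult_ac)
qed

text \<open>An element of \<open>K(x)\<close> that is algebraic over \<open>K\<close> lies in \<open>K\<close>.\<close>
lemma homogenize_eq_0:
  fixes A B :: "'a::field poly"
  assumes nz: "A \<noteq> 0" "B \<noteq> 0" and C: "C \<noteq> 0" "degree C \<le> T"
    and 0: "homogenize T C A B (\<lambda>c. [:c:]) = 0"
  obtains c where "c \<noteq> 0" "A = Polynomial.smult c B" "poly C c = 0"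
proof -
  \<comment> \<open>With c = 0, \<open>homogenize_nonzero\<close> excludes deg A < deg B; the
    reversed polynomial excludes the opposite inequality.\<close>
  have 1: "\<not> degree A < degree B" using homogenize_nonzero[of B A 0 C T] assms by auto
  obtain C' where C': "degree C' \<le> T" "C' \<noteq> 0" "\<And>(A :: 'a poly) B h. homogenize T C' A B h = homogenize T C B A h"
    using homogenize_reflect[OF C(2,1)] by metis
  have "\<not> degree B < degree A" using homogenize_nonzero[of A B 0 C' T] assms C' by auto
  with 1 have deg: "degree A = degree B" by linarith
  \<comment> \<open>The only c for which the leading terms of A and c B cancel.\<close>
  define c where "c = lead_coeff A / lead_coeff B"
  have c: "c \<noteq> 0" using nz by (simp add: c_def)
  have A: "A = Polynomial.smult c B"
  proof (rule ccontr)
    assume ne: "A \<noteq> Polynomial.smult c B"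
    have lc: "coeff (A - Polynomial.smult c B) (degree B) = 0" using nz deg by (simp add: c_def)
    have "degree (A - Polynomial.smult c B) \<le> degree B" by (intro degree_diff_le) (auto simp: deg)
    moreover have "degree (A - Polynomial.smult c B) \<noteq> degree B"
      using lc ne by (metis eq_iff_diff_eq_0 leading_coeff_0_iff)
    ultimately show False using homogenize_nonzero[of B A c C T] ne assms by auto
  qed
  \<comment> \<open>With A = c B the form collapses to C(c) B^T.\<close>
  have "poly C c = (\<Sum>t\<le>T. coeff C t * c ^ t)"
    by (rule poly_as_sum_of_monoms'[OF C(2), THEN arg_cong, of "\<lambda>p. poly p c", symmetric, unfolded poly_sum poly_monom])
  then have "Polynomial.smult (poly C c) (B ^ T) = (\<Sum>t\<le>T. Polynomial.smult (coeff C t * c ^ t) (B ^ T))"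
    by (simp only: smult_sum)
  also have "\<dots> = homogenize T C A B (\<lambda>c. [:c:])"
    unfolding homogenize_def A by (rule sum.cong) (auto simp: smult_power power_add[symmetric] mult_ac)
  finally have "poly C c = 0" using nz 0 by simp
  with c A that show ?thesis by blast
qed

lemma hom_homogenize:
  assumes "comm_ring_hom k"
  shows "k (homogenize T C A B h) = homogenize T C (k A) (k B) (\<lambda>c. k (h c))"
  by (simp add: homogenize_def comm_ring_hom_simps[OF assms])

section \<open>Weighted components as forms in two monomials\<close>

lemma monom2: "const2 c * X2 ^ i * Y2 ^ j = monom (monom c i) j"
proof -
  have "X2 ^ i = [:monom (1::'a) i:]"
    by (induction i) (auto simp: monom_Suc one_pCons monom_0)
  moreover have "Y2 ^ j = monom (1 :: 'a poly) j"
    by (induction j) (auto simp: monom_Suc monom_0)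
  ultimately show ?thesis by (simp add: smult_monom)
qed

lemma coeff_top_part:
  "coeff (coeff (top_part m n W F) j) i = (if i * m + j * n = W then coeff (coeff F j) i else 0)"
proof -
  have fin: "finite {(i, j)\<in>supp2 F. i * m + j * n = W}"
    by (rule finite_subset[OF _ finite_supp2[of F]]) auto
  have "coeff (coeff (top_part m n W F) j) i =
     (\<Sum>x\<in>{(i, j)\<in>supp2 F. i * m + j * n = W}. if (i, j) = x then coeff (coeff F j) i else 0)"
    unfolding top_part_def monom2 by (auto simp: coeff_sum intro!: sum.cong)
  also have "\<dots> = (if i * m + j * n = W then coeff (coeff F j) i else 0)"
    using fin by (subst sum.delta') (auto simp: supp2_def)
  finally show ?thesis .
qed

text \<open>Exponent pairs of equal weight differ by a multiple of (n1, -m1), because n1 and m1 are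
  coprime. The component is therefore a monomial times a form in x^n1 and y^m1.\<close>

lemma top_part_homogenize:
  fixes F :: "'a::comm_ring_1 poly poly"
  assumes cop: "coprime n1 m1" and pos: "n1 > 0" "m1 > 0" "d > 0"
    and mn: "m = m1 * d" "n = n1 * d"
    and ab: "(a, b) \<in> supp2 F" "a * m + b * n = W"
  obtains i0 j0 T C where "C \<noteq> 0" "degree C \<le> T"
    "top_part m n W F = X2 ^ i0 * Y2 ^ j0 * homogenize T C (X2 ^ n1) (Y2 ^ m1) const2"
proof -
  define I where "I = {(i, j)\<in>supp2 F. i * m + j * n = W}"
  define i0 where "i0 = (LEAST i. \<exists>j. (i, j) \<in> I)"
  have "\<exists>i j. (i, j) \<in> I" using ab by (auto simp: I_def)
  then have "\<exists>j. (i0, j) \<in> I" unfolding i0_def by (rule LeastI_ex)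
  then obtain J where J: "(i0, J) \<in> I" by blast
  have i0: "i0 \<le> i" if "(i, j) \<in> I" for i j
    unfolding i0_def by (rule Least_le) (use that in blast)
  \<comment> \<open>T is how many steps (n1, -m1) fit from (i0, J) before the power of y would
    become negative; j0 is the power of y left over.\<close>
  define T where "T = J div m1"
  define j0 where "j0 = J mod m1"
  have T: "t \<le> T \<longleftrightarrow> m1 * t \<le> J" for t
    unfolding T_def using pos by (simp add: less_eq_div_iff_mult_less_eq mult.commute)
  define C where "C = (\<Sum>t\<le>T. monom (coeff (coeff F (J - m1 * t)) (i0 + n1 * t)) t)"
  have C: "coeff C t = (if t \<le> T then coeff (coeff F (J - m1 * t)) (i0 + n1 * t) else 0)" for t
    by (simp add: C_def coeff_sum)
  have "coeff C 0 \<noteq> 0" using J by (simp add: C I_def supp2_def)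
  then have C0: "C \<noteq> 0" by auto
  have degC: "degree C \<le> T" by (rule degree_le) (simp add: C)
  define K where "K = {t. t \<le> T \<and> coeff C t \<noteq> 0}"
  have "bij_betw (\<lambda>t. (i0 + n1 * t, J - m1 * t)) K I"
    unfolding bij_betw_def
  proof safe
    show "inj_on (\<lambda>t. (i0 + n1 * t, J - m1 * t)) K" using pos by (auto simp: inj_on_def)
  next
    fix t assume "t \<in> K"
    then have t: "m1 * t \<le> J" "coeff (coeff F (J - m1 * t)) (i0 + n1 * t) \<noteq> 0"
      using T by (auto simp: K_def C)
    have "(i0 + n1 * t) * m + (J - m1 * t) * n = i0 * m + J * n"
    proof -
      obtain r where "J = m1 * t + r" using t(1) le_Suc_ex by blast
      then show ?thesis by (simp add: mn algebra_simps)
    qed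
    then show "(i0 + n1 * t, J - m1 * t) \<in> I" using t J by (auto simp: I_def supp2_def)
  next
    fix i j assume ij: "(i, j) \<in> I"
    obtain r where r: "i = i0 + r" using i0[OF ij] le_Suc_ex by blast
    have "(i0 + r) * m1 * d + j * n1 * d = i0 * m1 * d + J * n1 * d"
      using ij J r by (simp add: I_def mn mult.assoc)
    then have "((i0 + r) * m1 + j * n1) * d = (i0 * m1 + J * n1) * d"
      by (simp only: add_mult_distrib)
    then have "(i0 + r) * m1 + j * n1 = i0 * m1 + J * n1" using pos by simp
    then have e: "r * m1 + j * n1 = J * n1" by (simp add: algebra_simps)
    then have "j * n1 \<le> J * n1" by linarith
    then have "j \<le> J" using pos by simp
    then obtain s where s: "J = j + s" using le_Suc_ex by blast
    with e have e': "r * m1 = s * n1" by (simp add: algebra_simps)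
    then have "n1 dvd r" using cop by (metis coprime_dvd_mult_left_iff dvd_triv_right)
    then obtain t where t: "r = n1 * t" by blast
    with e' pos have "s = m1 * t" by (simp add: mult.commute)
    with r s t have "i = i0 + n1 * t" "j = J - m1 * t" "m1 * t \<le> J" by auto
    moreover from this have "t \<in> K" using ij T by (auto simp: K_def C I_def supp2_def)
    ultimately show "(i, j) \<in> (\<lambda>t. (i0 + n1 * t, J - m1 * t)) ` K" by auto
  qed
  then have "top_part m n W F = (\<Sum>t\<in>K. const2 (coeff (coeff F (J - m1 * t)) (i0 + n1 * t))
      * X2 ^ (i0 + n1 * t) * Y2 ^ (J - m1 * t))"
    unfolding top_part_def I_def[symmetric]
    by (subst sum.reindex_bij_betw[symmetric]) (auto simp: case_prod_unfold)
  also have "\<dots> = (\<Sum>t\<in>K. X2 ^ i0 * Y2 ^ j0 * (const2 (coeff C t) * (X2 ^ n1) ^ t * (Y2 ^ m1) ^ (T - t)))"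
  proof (rule sum.cong[OF refl])
    fix t assume "t \<in> K"
    then have t: "t \<le> T" by (simp add: K_def)
    have "J - m1 * t = j0 + m1 * (T - t)"
    proof -
      have "J = m1 * T + j0" by (simp add: T_def j0_def)
      moreover obtain r where "T = t + r" using t le_Suc_ex by blast
      ultimately show ?thesis by (simp add: algebra_simps)
    qed
    then show "const2 (coeff (coeff F (J - m1 * t)) (i0 + n1 * t)) * X2 ^ (i0 + n1 * t) * Y2 ^ (J - m1 * t) =
        X2 ^ i0 * Y2 ^ j0 * (const2 (coeff C t) * (X2 ^ n1) ^ t * (Y2 ^ m1) ^ (T - t))"
      using t by (simp only: C if_True power_add power_mult mult_ac)
  qed
  also have "\<dots> = (\<Sum>t\<le>T. X2 ^ i0 * Y2 ^ j0 * (const2 (coeff C t) * (X2 ^ n1) ^ t * (Y2 ^ m1) ^ (T - t)))"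
    by (rule sum.mono_neutral_left) (auto simp: K_def)
  also have "\<dots> = X2 ^ i0 * Y2 ^ j0 * homogenize T C (X2 ^ n1) (Y2 ^ m1) const2"
    by (simp only: homogenize_def sum_distrib_left)
  finally show ?thesis using that C0 degC by blast
qed

section \<open>Polynomials in u, v, s and their weights\<close>

definition const3 :: "'a::comm_ring_1 \<Rightarrow> 'a poly poly poly" where
  "const3 c = [:const2 c:]"

lemma const3_hom: "comm_ring_hom const3"
  unfolding const3_def by (rule comm_ring_hom_comp[OF const_poly_hom const2_hom])

text \<open>Sends \<open>u\<close>, \<open>v\<close>, \<open>s\<close> to \<open>u T\<^bsup>-M\<^esup>\<close>, \<open>v T\<^bsup>-L\<^esup>\<close>, \<open>s T\<^bsup>\<tau>\<^esup>\<close>. The weight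
  of \<open>s\<close> may have either sign, hence the Laurent series.\<close>
definition weight_hom :: "nat \<Rightarrow> nat \<Rightarrow> int \<Rightarrow> 'a::comm_ring_1 poly poly poly \<Rightarrow> 'a poly poly poly fls" where
  "weight_hom M L \<tau> P = poly (map_poly (eval2 (\<lambda>c. fls_const (const3 c))
     (fls_const [:X2:] * fls_X_intpow (- int M)) (fls_const [:Y2:] * fls_X_intpow (- int L))) P)
     (fls_const [:0, 1:] * fls_X_intpow \<tau>)"

lemma weight_hom_hom: "comm_ring_hom (weight_hom M L \<tau>)"
  unfolding weight_hom_def by (intro map_poly_hom_aux eval2_hom fls_const_hom const3_hom)

lemma weight_hom_const:
  "weight_hom M L \<tau> [:p:] = eval2 (\<lambda>c. fls_const (const3 c))
     (fls_const [:X2:] * fls_X_intpow (- int M)) (fls_const [:Y2:] * fls_X_intpow (- int L)) p"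
proof -
  have "eval2 (\<lambda>c. fls_const (const3 c)) a b 0 = 0" for a b :: "'b::comm_ring_1 poly poly poly fls"
    by (rule comm_ring_hom_simps(6)[OF eval2_hom[OF fls_const_hom[OF const3_hom]]])
  then show ?thesis by (cases "p = 0") (simp_all add: weight_hom_def map_poly_pCons)
qed

lemma fls_nth_const_X_intpow_mult:
  "fls_nth (fls_const c * fls_X_intpow k * x) i = c * fls_nth x (i - k)" for c :: "'a::comm_ring_1"
proof -
  have "fls_const c * fls_X_intpow k * x = fls_const c * fls_shift (- k) x"
    by (simp only: mult.assoc fls_X_intpow_times_conv_shift(1))
  then show ?thesis by simp
qed

lemma coeff_weight_hom_const:
  fixes p :: "'a::comm_ring_1 poly poly"
  shows "coeff (coeff (coeff (fls_nth (weight_hom M L \<tau> [:p:]) k) l) j) i =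
     (if l = 0 \<and> k = - int (i * M + j * L) then coeff (coeff p j) i else 0)"
proof -
  let ?h = "\<lambda>c :: 'a. fls_const (const3 c)"
  let ?u = "fls_const [:X2:] * fls_X_intpow (- int M)" and ?v = "fls_const [:Y2:] * fls_X_intpow (- int L)"
  have h: "comm_ring_hom ?h" by (intro fls_const_hom const3_hom)
  have const_power: "[:x:] ^ n = [:x ^ n:]" for x :: "'a poly poly" and n
    by (induction n) (auto simp: one_pCons)
  have mono: "?h c * ?u ^ i * ?v ^ j = fls_const [:monom (monom c i) j:] * fls_X_intpow (- int (i * M + j * L))"
    for c :: 'a and i j
  proof -
    have "?h c * ?u ^ i * ?v ^ j = fls_const (const3 c * [:X2:] ^ i * [:Y2:] ^ j)
        * (fls_X_intpow (int i * - int M) * fls_X_intpow (int j * - int L))"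
      by (simp only: power_mult_distrib fls_X_intpow_power fls_const_power[symmetric]
        fls_const_mult_const[symmetric] of_nat_id mult_ac)
    also have "const3 c * [:X2:] ^ i * [:Y2:] ^ j = [:const2 c * X2 ^ i * Y2 ^ j:]"
      by (simp add: const3_def const_power mult_ac)
    also have "fls_X_intpow (int i * - int M) * fls_X_intpow (int j * - int L) =
        (fls_X_intpow (- int (i * M + j * L)) :: 'a poly poly poly fls)"
      unfolding fls_X_intpow_times_fls_X_intpow by (simp add: algebra_simps)
    finally show ?thesis by (simp only: monom2)
  qed
  have "fls_nth (weight_hom M L \<tau> [:p:]) k =
     (\<Sum>(i, j)\<in>supp2 p. if k = - int (i * M + j * L) then [:monom (monom (coeff (coeff p j) i) i) j:] else 0)"
    unfolding weight_hom_const eval2_sum[OF h] mono fls_nth_sum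
    by (rule sum.cong) (auto simp: fls_X_intpow_times_conv_shift)
  then have "coeff (coeff (coeff (fls_nth (weight_hom M L \<tau> [:p:]) k) l) j) i =
     (\<Sum>x\<in>supp2 p. if (i, j) = x then (if l = 0 \<and> k = - int (i * M + j * L) then coeff (coeff p j) i else 0) else 0)"
    by (simp only: coeff_sum) (rule sum.cong, auto simp: coeff_pCons split: nat.splits if_splits)
  also have "\<dots> = (if l = 0 \<and> k = - int (i * M + j * L) then coeff (coeff p j) i else 0)"
    by (subst sum.delta'[OF finite_supp2]) (auto simp: supp2_def)
  finally show ?thesis .
qed

text \<open>The monomial u^i v^j s^l is multiplied by T^(\<tau> l - i M - j L), so each coefficient
  survives at exactly one order. In the induction, a factor s shifts the power of s by 1 and the
  order by \<tau>.\<close>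

lemma coeff_weight_hom:
  "coeff (coeff (coeff (fls_nth (weight_hom M L \<tau> P) k) l) j) i =
     (if k = \<tau> * int l - int (i * M + j * L) then coeff (coeff (coeff P l) j) i else 0)"
proof (induction P arbitrary: k l)
  case 0
  show ?case by (simp add: comm_ring_hom_simps(6)[OF weight_hom_hom])
next
  case (pCons p P)
  note hom = comm_ring_hom_simps[OF weight_hom_hom]
  have s: "weight_hom M L \<tau> [:0, 1:] = fls_const [:0, 1:] * fls_X_intpow \<tau>"
  proof -
    note e = comm_ring_hom_simps[OF eval2_hom[OF fls_const_hom[OF const3_hom]]]
    show ?thesis unfolding weight_hom_def by (simp add: map_poly_pCons e)
  qed
  have "pCons p P = [:p:] + [:0, 1:] * P" by simp
  then have "weight_hom M L \<tau> (pCons p P) = weight_hom M L \<tau> [:p:] + fls_const [:0, 1:] * fls_X_intpow \<tau> * weight_hom M L \<tau> P"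
    by (simp only: hom s)
  then have "coeff (fls_nth (weight_hom M L \<tau> (pCons p P)) k) l =
      coeff (fls_nth (weight_hom M L \<tau> [:p:]) k) l + coeff (pCons 0 (fls_nth (weight_hom M L \<tau> P) (k - \<tau>))) l"
    by (simp add: fls_nth_const_X_intpow_mult)
  then show ?case
    by (cases l) (simp_all add: coeff_weight_hom_const pCons.IH algebra_simps)
qed

section \<open>Degrees of the components of an automorphism\<close>

text \<open>Choice of the weight \<open>\<tau> / N\<close> of \<open>s\<close>: the largest one for which no monomial of \<open>P\<close> or \<open>Q\<close>
  exceeds the weight of \<open>u\<close> resp. \<open>v\<close>.\<close>
lemma exists_maximal_slope:
  fixes S :: "(int \<times> nat) set"
  assumes "finite S" "S \<noteq> {}" "\<And>a l. (a, l) \<in> S \<Longrightarrow> l > 0"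
  obtains a0 l0 where "(a0, l0) \<in> S" "\<And>a l. (a, l) \<in> S \<Longrightarrow> a * int l0 \<le> a0 * int l"
proof -
  \<comment> \<open>Slopes are compared as rationals; the conclusion is cross-multiplied to stay in
    the integers.\<close>
  let ?r = "\<lambda>(a, l). of_int a / (of_nat l :: rat)"
  have "Max (?r ` S) \<in> ?r ` S" using assms by (intro Max_in) auto
  then obtain a0 l0 where 0: "(a0, l0) \<in> S" "Max (?r ` S) = ?r (a0, l0)" by auto
  have "a * int l0 \<le> a0 * int l" if al: "(a, l) \<in> S" for a l
  proof -
    have "?r (a, l) \<le> ?r (a0, l0)" using Max_ge[of "?r ` S" "?r (a, l)"] imageI[OF al, of ?r] assms(1) 0(2) by auto
    then have "of_int a * (of_nat l0 :: rat) \<le> of_int a0 * of_nat l"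
      using assms(3)[OF al] assms(3)[OF 0(1)] by (simp add: field_simps)
    then have "of_int (a * int l0) \<le> (of_int (a0 * int l) :: rat)" by simp
    then show ?thesis by (simp only: of_int_le_iff)
  qed
  with 0 that show ?thesis by blast
qed

text \<open>When s has weight -\<tau>/N, the monomial u^i v^j s^l has weight at most w exactly if (i
  m + j n - w)/l \<le> \<tau>/N. The pairs record numerator and denominator of the left
  side.\<close>

definition slopes :: "nat \<Rightarrow> nat \<Rightarrow> nat \<Rightarrow> 'a::zero poly poly poly \<Rightarrow> (int \<times> nat) set" where
  "slopes m n w P = {(int (i * m + j * n) - int w, l) | i j l. l > 0 \<and> coeff (coeff (coeff P l) j) i \<noteq> 0}"

lemma finite_slopes: "finite (slopes m n w P)"
proof -
  have "slopes m n w P \<subseteq> (\<lambda>(l, i, j). (int (i * m + j * n) - int w, l)) `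
      (SIGMA l:{..degree P}. supp2 (coeff P l))"
  proof
    fix x assume "x \<in> slopes m n w P"
    then obtain i j l where x: "x = (int (i * m + j * n) - int w, l)" "coeff (coeff (coeff P l) j) i \<noteq> 0"
      unfolding slopes_def by blast
    then have "coeff P l \<noteq> 0" by auto
    then have "l \<le> degree P" by (rule le_degree)
    with x show "x \<in> (\<lambda>(l, i, j). (int (i * m + j * n) - int w, l)) `
      (SIGMA l:{..degree P}. supp2 (coeff P l))"
      by (intro image_eqI[where x = "(l, i, j)"]) (auto simp: supp2_def)
  qed
  then show ?thesis by (rule finite_subset) (simp add: finite_supp2)
qed

lemma slopes_empty:
  assumes "slopes m n w P = {}"
  shows "P = [:coeff P 0:]"
proof (rule poly_eqI)
  fix l show "coeff P l = coeff [:coeff P 0:] l"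
  proof (cases l)
    case (Suc l')
    have "coeff P l = 0"
    proof (intro poly_eqI)
      fix j i show "coeff (coeff (coeff P l) j) i = coeff (coeff 0 j) i"
        using assms Suc unfolding slopes_def by (simp, blast)
    qed
    with Suc show ?thesis by simp
  qed simp
qed

text \<open>The slope bound keeps all monomials of P within weight w, and the s-free one, of weight
  w itself, survives at order -N w. If (\<tau>, N) is one of the slopes, a monomial with s^N
  survives there too.\<close>

lemma weight_hom_top:
  fixes m n w i0 j0 N :: nat and \<tau> :: int and P :: "'a::comm_ring_1 poly poly poly"
  defines "p \<equiv> weight_hom (N * m) (N * n) \<tau> P"
  assumes P0: "coeff P 0 = monom (monom 1 i0) j0" and w: "w = i0 * m + j0 * n"
    and N: "N > 0"
    and le: "\<And>a l. (a, l) \<in> slopes m n w P \<Longrightarrow> a * int N \<le> \<tau> * int l"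
  shows "fls_ge (- int (N * w)) p" "coeff (fls_nth p (- int (N * w))) 0 = coeff P 0"
    "(\<tau>, N) \<in> slopes m n w P \<Longrightarrow> coeff (fls_nth p (- int (N * w))) N \<noteq> 0"
proof -
  note c = coeff_weight_hom[of "N * m" "N * n" \<tau> P, folded p_def]
  have e: "int (i * (N * m) + j * (N * n)) = int N * int (i * m + j * n)" for i j
    by (simp add: algebra_simps)
  show "fls_ge (- int (N * w)) p"
    unfolding fls_ge_def
  proof (intro allI impI poly_eqI)
    fix k l j i assume k: "k < - int (N * w)"
    have "False" if ne: "coeff (coeff (coeff P l) j) i \<noteq> 0" and k': "k = \<tau> * int l - int N * int (i * m + j * n)"
    proof (cases "l = 0")
      case True
      then have "i = i0 \<and> j = j0" using ne P0 by (auto split: if_splits)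
      with True k' k w show False by simp
    next
      case False
      then have "(int (i * m + j * n) - int w) * int N \<le> \<tau> * int l"
        using ne by (intro le) (auto simp: slopes_def)
      with k k' show False by (simp add: algebra_simps)
    qed
    then show "coeff (coeff (coeff (fls_nth p k) l) j) i = coeff (coeff (coeff 0 l) j) i"
      unfolding c e by auto
  qed
  show "coeff (fls_nth p (- int (N * w))) 0 = coeff P 0"
  proof (intro poly_eqI)
    fix j i
    show "coeff (coeff (coeff (fls_nth p (- int (N * w))) 0) j) i = coeff (coeff (coeff P 0) j) i"
      unfolding c e using w by (auto simp: P0 algebra_simps)
  qed
  assume "(\<tau>, N) \<in> slopes m n w P"
  then obtain i j where ij: "\<tau> = int (i * m + j * n) - int w" "coeff (coeff (coeff P N) j) i \<noteq> 0"
    unfolding slopes_def by blast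
  then have "- int (N * w) = \<tau> * int N - int N * int (i * m + j * n)"
    unfolding ij(1) by (simp add: algebra_simps)
  with ij have "coeff (coeff (coeff (fls_nth p (- int (N * w))) N) j) i \<noteq> 0" unfolding c e by simp
  then show "coeff (fls_nth p (- int (N * w))) N \<noteq> 0" by auto
qed

section \<open>The lifted pair f(F, G + s), g(F, G + s)\<close>

lemma const_poly_eval2:
  fixes p :: "'a::comm_ring_1 poly poly"
  shows "[:p:] = eval2 const3 [:X2:] [:Y2:] p"
proof -
  have "(\<lambda>c. [:const2 c:]) = (const3 :: 'a \<Rightarrow> _)" by (simp add: fun_eq_iff const3_def)
  then show ?thesis
    using hom_eval2[OF const2_hom const_poly_hom, of X2 Y2 p] subst2_id[of p]
    by (simp only: subst2_eval2 fst_conv snd_conv)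
qed

lemma coeff_0_hom: "comm_ring_hom (\<lambda>p :: 'a::comm_ring_1 poly. coeff p 0)"
  by unfold_locales (auto simp: coeff_mult)

text \<open>\<open>[:G, 1:]\<close> is G + s. Since F(f, g) = x, evaluation at (F, G + s) returns F;
  setting s = 0 turns f(F, G + s) into f(F, G) = x.\<close>

lemma eval2_lift:
  assumes "eval2 const2 f g F = X2" "eval2 const2 F G f = X2"
  shows "eval2 const3 (eval2 const3 [:F:] [:G, 1:] f) (eval2 const3 [:F:] [:G, 1:] g) F = [:F:]"
    "coeff (eval2 const3 [:F:] [:G, 1:] f) 0 = X2"
proof -
  show "eval2 const3 (eval2 const3 [:F:] [:G, 1:] f) (eval2 const3 [:F:] [:G, 1:] g) F = [:F:]"
    using assms(1) by (simp add: eval2_eval2[OF const3_hom, symmetric] eval2_simps[OF const3_hom])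
  show "coeff (eval2 const3 [:F:] [:G, 1:] f) 0 = X2"
    using assms(2) by (simp add: hom_eval2[OF const3_hom coeff_0_hom] const3_def)
qed

text \<open>At the lowest order, F(P, Q) = F says that the leading part of F takes the same value at
  (p, q) and (u, v). Its divisor p^n1 - c q^m1 is thus free of s, so \<open>cusp_curve_rigid\<close>
  gives p = u and q = v, although s^N occurs in p or q.\<close>

lemma aut_weighted_degree:
  fixes f g F G :: "'a::field poly poly"
  assumes inv: "eval2 const2 f g F = X2" "eval2 const2 f g G = Y2"
    "eval2 const2 F G f = X2" "eval2 const2 F G g = Y2"
    and cop: "coprime n1 m1" "n1 \<ge> 2" "m1 \<ge> 2" and d: "d > 0"
    and mn: "m = m1 * d" "n = n1 * d"
    and W: "\<And>i j. (i, j) \<in> supp2 F \<Longrightarrow> i * m + j * n \<le> W"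
    and dvd: "\<And>A B :: 'a poly poly poly. A ^ n1 - const3 c * B ^ m1 dvd eval2 const3 A B (top_part m n W F)"
    and top: "top_part m n W F \<noteq> 0" and c: "c \<noteq> 0"
  shows False
proof -
  define P where "P = eval2 const3 [:F:] [:G, 1:] f"
  define Q where "Q = eval2 const3 [:F:] [:G, 1:] g"
  have PQ: "eval2 const3 P Q F = [:F:]" "coeff P 0 = X2"
    using eval2_lift[OF inv(1,3)] by (auto simp: P_def Q_def)
  have QG: "eval2 const3 P Q G = [:G, 1:]"
    using inv(2) by (simp add: P_def Q_def eval2_eval2[OF const3_hom, symmetric] eval2_simps[OF const3_hom])
  have Q0: "coeff Q 0 = Y2"
    using inv(4) by (simp add: Q_def hom_eval2[OF const3_hom coeff_0_hom]) (simp add: const3_def)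
  have X2m: "X2 = monom (monom (1::'a) 1) 0" and Y2m: "Y2 = monom (monom (1::'a) 0) 1"
    by (simp_all add: monom_altdef one_pCons)
  define S where "S = slopes m n m P \<union> slopes m n n Q"
  \<comment> \<open>G(P, Q) = G + s, so s must occur in P or Q.\<close>
  have "S \<noteq> {}"
  proof
    assume "S = {}"
    then have "P = [:X2:]" "Q = [:Y2:]"
      using slopes_empty PQ(2) Q0 unfolding S_def by (metis Un_empty)+
    then have "[:G, 1:] = [:G:]" using QG const_poly_eval2[of G] by simp
    then show False by simp
  qed
  moreover have "finite S" by (simp add: S_def finite_slopes)
  moreover have "l > 0" if "(a, l) \<in> S" for a l using that by (auto simp: S_def slopes_def)
  ultimately obtain \<tau> N where \<tau>: "(\<tau>, N) \<in> S" and N: "N > 0"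
    and le: "\<And>a l. (a, l) \<in> S \<Longrightarrow> a * int N \<le> \<tau> * int l"
    using exists_maximal_slope[of S] by metis
  define \<Phi> where "\<Phi> = (weight_hom (N * m) (N * n) \<tau> :: 'a poly poly poly \<Rightarrow> _)"
  define p where "p = fls_nth (\<Phi> P) (- int (N * m))"
  define q where "q = fls_nth (\<Phi> Q) (- int (N * n))"
  have P: "fls_ge (- int (N * m)) (\<Phi> P)" "coeff p 0 = X2"
      "(\<tau>, N) \<in> slopes m n m P \<Longrightarrow> coeff p N \<noteq> 0"
    using weight_hom_top[of P 1 0 m m n N \<tau>] N le PQ(2)
    unfolding p_def \<Phi>_def S_def X2m by auto
  have Q: "fls_ge (- int (N * n)) (\<Phi> Q)" "coeff q 0 = Y2"
      "(\<tau>, N) \<in> slopes m n n Q \<Longrightarrow> coeff q N \<noteq> 0"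
    using weight_hom_top[of Q 0 1 n m n N \<tau>] N le Q0
    unfolding q_def \<Phi>_def S_def Y2m by auto
  have \<Phi>c: "\<Phi> (const3 c) = fls_const (const3 c)" for c
  proof -
    have "\<Phi> (const3 c) = \<Phi> [:const2 c:]" by (simp only: const3_def)
    then show ?thesis by (simp only: \<Phi>_def weight_hom_const eval2_simps[OF fls_const_hom[OF const3_hom]])
  qed
  have "eval2 (\<lambda>c. fls_const (const3 c)) (\<Phi> P) (\<Phi> Q) F = \<Phi> (eval2 const3 P Q F)"
    unfolding \<Phi>_def hom_eval2[OF const3_hom weight_hom_hom] \<Phi>c[unfolded \<Phi>_def] ..
  also have "\<dots> = eval2 (\<lambda>c. fls_const (const3 c)) (fls_const [:X2:] * fls_X_intpow (- int (N * m)))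
      (fls_const [:Y2:] * fls_X_intpow (- int (N * n))) F" (is "_ = eval2 _ ?u ?v F")
    by (simp only: PQ \<Phi>_def weight_hom_const)
  finally have "fls_nth (eval2 (\<lambda>c. fls_const (const3 c)) (\<Phi> P) (\<Phi> Q) F) (- int (N * W)) =
      fls_nth (eval2 (\<lambda>c. fls_const (const3 c)) ?u ?v F) (- int (N * W))" by simp
  moreover have "fls_nth (eval2 (\<lambda>c. fls_const (const3 c)) (\<Phi> P) (\<Phi> Q) F) (- int (N * W)) =
      eval2 const3 p q (top_part m n W F)"
    unfolding p_def q_def by (rule fls_nth_eval2_top[OF const3_hom N P(1) Q(1) W])
  moreover have "fls_nth (eval2 (\<lambda>c. fls_const (const3 c)) ?u ?v F) (- int (N * W)) =
      eval2 const3 [:X2:] [:Y2:] (top_part m n W F)"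
    by (subst fls_nth_eval2_top[OF const3_hom N _ _ W])
       (auto simp: fls_ge_def fls_X_intpow_times_conv_shift)
  ultimately have eq: "eval2 const3 p q (top_part m n W F) = [:top_part m n W F:]"
    using const_poly_eval2 by metis
  define r where "r = p ^ n1 - const3 c * q ^ m1"
  \<comment> \<open>A divisor of a nonzero polynomial free of s is free of s, so r equals its value
    at s = 0.\<close>
  have "r dvd [:top_part m n W F:]" using dvd[of p q] eq by (simp add: r_def)
  then have "degree r \<le> degree [:top_part m n W F:]" using top by (intro dvd_imp_degree_le) auto
  then have "r = [:coeff r 0:]" by (simp add: degree_0_id)
  also have "coeff r 0 = X2 ^ n1 - const2 c * Y2 ^ m1"
    unfolding r_def using P(2) Q(2) by (simp add: comm_ring_hom_simps[OF coeff_0_hom] const3_def)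
  finally have "p = [:X2:] \<and> q = [:Y2:]"
    using cusp_curve_rigid[OF P(2) Q(2) c cop] by (simp add: r_def const3_def)
  then have "coeff p N = 0" "coeff q N = 0" using N by (auto simp: coeff_pCons split: nat.splits)
  with P(3) Q(3) \<tau> show False by (auto simp: S_def)
qed

text \<open>F(f, g) = x contains no y, so the leading part of F vanishes at the leading coefficients
  of f and g. Being a form, it yields a root c with lc(f)^n1 = c lc(g)^m1. Unless n1 or m1 is 1,
  this root contradicts \<open>aut_weighted_degree\<close>.\<close>

lemma aut_degree_dvd:
  fixes f g F G :: "'a::field poly poly"
  assumes inv: "eval2 const2 f g F = X2" "eval2 const2 f g G = Y2"
    "eval2 const2 F G f = X2" "eval2 const2 F G g = Y2"
    and deg: "degree f > 0" "degree g > 0"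
  obtains (1) c k where "k > 0" "degree f = k * degree g" "lead_coeff f = Polynomial.smult c (lead_coeff g ^ k)"
  | (2) c k where "k > 0" "degree g = k * degree f" "lead_coeff g = Polynomial.smult c (lead_coeff f ^ k)"
proof -
  define m n where "m = degree f" and "n = degree g"
  define d where "d = gcd m n"
  have d: "d > 0" using deg by (simp add: d_def m_def)
  obtain m1 n1 where mn: "m = m1 * d" "n = n1 * d" and cop: "coprime n1 m1"
    using gcd_coprime_exists[of m n] d unfolding d_def by (metis coprime_commute less_irrefl)
  have pos: "m1 > 0" "n1 > 0" using mn deg by (auto simp: m_def n_def)
  have "eval2 const2 f g 0 = 0" by (rule comm_ring_hom_simps(6)[OF eval2_hom[OF const2_hom]])
  then have F0: "F \<noteq> 0" using inv(1) by auto
  then have ne: "supp2 F \<noteq> {}" using poly2_sum[of F] by auto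
  define W where "W = Max ((\<lambda>(i, j). i * m + j * n) ` supp2 F)"
  have W: "i * m + j * n \<le> W" if "(i, j) \<in> supp2 F" for i j
    unfolding W_def using that finite_supp2 by (intro Max_ge) force+
  have "W \<in> (\<lambda>(i, j). i * m + j * n) ` supp2 F"
    unfolding W_def using ne finite_supp2 by (intro Max_in) auto
  then obtain a b where ab: "(a, b) \<in> supp2 F" "a * m + b * n = W" by auto
  \<comment> \<open>Both weights are positive, so W = 0 would make F constant.\<close>
  have "W > 0"
  proof (rule ccontr)
    assume "\<not> W > 0"
    then have "(i, j) = (0, 0)" if "(i, j) \<in> supp2 F" for i j
      using W[OF that] deg by (simp add: m_def n_def)
    then have "supp2 F = {(0, 0)}" using ne by auto
    then have "X2 = const2 (coeff (coeff F 0) 0)" using inv(1) eval2_sum[OF const2_hom, of f g F] by simp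
    then show False by simp
  qed
  obtain i0 j0 T C where C: "C \<noteq> 0" "degree C \<le> T"
    "top_part m n W F = X2 ^ i0 * Y2 ^ j0 * homogenize T C (X2 ^ n1) (Y2 ^ m1) const2"
    using top_part_homogenize[OF cop pos(2,1) d mn ab] by metis
  have top: "eval2 h x y (top_part m n W F) = x ^ i0 * y ^ j0 * homogenize T C (x ^ n1) (y ^ m1) h"
    if "comm_ring_hom h" for h :: "'a \<Rightarrow> 'b::comm_ring_1" and x y
    by (simp only: C(3) comm_ring_hom_simps[OF eval2_hom[OF that]] hom_homogenize[OF eval2_hom[OF that]] eval2_simps[OF that])
  have "coeff (eval2 const2 f g F) W = 0" using inv(1) \<open>W > 0\<close> by (simp add: coeff_pCons split: nat.splits)
  then have "eval2 (\<lambda>c. [:c:]) (lead_coeff f) (lead_coeff g) (top_part m n W F) = 0"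
    using coeff_eval2_top[OF const_poly_hom, of f m g n F W] W by (simp add: m_def n_def)
  then have "homogenize T C (lead_coeff f ^ n1) (lead_coeff g ^ m1) (\<lambda>c. [:c:]) = 0"
    using deg by (auto simp: top[OF const_poly_hom])
  then obtain c where c: "c \<noteq> 0" "lead_coeff f ^ n1 = Polynomial.smult c (lead_coeff g ^ m1)" "poly C c = 0"
    using homogenize_eq_0[of "lead_coeff f ^ n1" "lead_coeff g ^ m1" C T] C deg by force
  show ?thesis
  \<comment> \<open>If n1 = 1 then n = d divides m; if m1 = 1 then m = d divides n, and the constant
    is inverted.\<close>
  proof (cases "n1 = 1 \<or> m1 = 1")
    case True
    then show ?thesis
    proof
      assume "n1 = 1"
      with c pos mn show ?thesis by (intro 1[of m1 c]) (auto simp: m_def n_def)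
    next
      assume "m1 = 1"
      with c pos mn show ?thesis by (intro 2[of n1 "inverse c"]) (auto simp: m_def n_def)
    qed
  next
    case False
    have "(A :: 'a poly poly poly) ^ n1 - const3 c * B ^ m1 dvd eval2 const3 A B (top_part m n W F)" for A B
      unfolding top[OF const3_hom] by (intro dvd_mult dvd_homogenize const3_hom C c)
    moreover have "coeff (coeff (top_part m n W F) b) a \<noteq> 0"
      using ab by (simp add: coeff_top_part supp2_def)
    then have "top_part m n W F \<noteq> 0" by auto
    ultimately have False
      using aut_weighted_degree[OF inv cop _ _ d mn W _ _ c(1)] False pos by simp
    then show ?thesis ..
  qed
qed

section \<open>Words of shears\<close>

text \<open>For the form \<lambda> = (a, b) this is v + A(\<lambda>(v)) w with w = (-b, a) in its
  kernel. A is an arbitrary function, so that substitution into P and multiplication by P are both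
  covered.\<close>

definition shear :: "'b \<times> 'b \<Rightarrow> ('b \<Rightarrow> 'b) \<Rightarrow> 'b \<times> 'b \<Rightarrow> 'b::comm_ring_1 \<times> 'b" where
  "shear d A v = (let q = A (fst d * fst v + snd d * snd v) in (fst v - snd d * q, snd v + fst d * q))"

text \<open>One representative for each point of the projective line; \<open>None\<close> is the
  point at infinity.\<close>

fun dir :: "'a::comm_ring_1 option \<Rightarrow> 'a \<times> 'a" where
  "dir None = (0, 1)"
| "dir (Some b) = (1, b)"

definition dir_hom :: "('a::comm_ring_1 \<Rightarrow> 'b) \<Rightarrow> 'a option \<Rightarrow> 'b \<times> 'b" where
  "dir_hom h d = map_prod h h (dir d)"

definition act :: "('a::comm_ring_1 \<Rightarrow> 'b::comm_ring_1) \<Rightarrow> 'a option \<times> 'a poly \<Rightarrow> 'b \<times> 'b \<Rightarrow> 'b \<times> 'b" where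
  "act h x = shear (dir_hom h (fst x)) (poly (map_poly h (snd x)))"

definition run :: "('a::comm_ring_1 \<Rightarrow> 'b::comm_ring_1) \<Rightarrow> ('a option \<times> 'a poly) list \<Rightarrow> 'b \<times> 'b \<Rightarrow> 'b \<times> 'b" where
  "run h w v = foldr (act h) w v"

lemma run_simps [simp]: "run h [] v = v" "run h (x # w) v = act h x (run h w v)"
  "run h (w @ w') v = run h w (run h w' v)"
  by (simp_all add: run_def)

text \<open>The inner shear does not change \<lambda>(v), because w lies in the kernel of \<lambda>;
  so the increments add up.\<close>

lemma shear_shear:
  assumes "\<And>x. C x = A x + B x"
  shows "shear d A (shear d B v) = shear d C v"
  by (simp add: shear_def Let_def assms algebra_simps)

lemma shear_0: "(\<And>x. A x = 0) \<Longrightarrow> shear d A v = v"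
  by (simp add: shear_def)

lemma poly_map_poly_hom:
  assumes "comm_ring_hom h"
  shows "poly (map_poly h (P + Q)) x = poly (map_poly h P) x + poly (map_poly h Q) x"
    "poly (map_poly h 0) x = 0"
    "comm_ring_hom k \<Longrightarrow> k (poly (map_poly h P) x) = poly (map_poly (\<lambda>a. k (h a)) P) (k x)"
proof -
  note hom = comm_ring_hom_simps[OF map_poly_hom_aux[OF assms]]
  show "poly (map_poly h (P + Q)) x = poly (map_poly h P) x + poly (map_poly h Q) x"
    "poly (map_poly h 0) x = 0" by (simp_all only: hom)
  assume k: "comm_ring_hom k"
  interpret h: comm_ring_hom h by fact
  interpret k: comm_ring_hom k by fact
  show "k (poly (map_poly h P) x) = poly (map_poly (\<lambda>a. k (h a)) P) (k x)"
  proof (induction P)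
    case (pCons a P)
    then show ?case by (simp add: map_poly_pCons hom_distribs)
  qed simp
qed

lemma act_act:
  "comm_ring_hom h \<Longrightarrow> act h (d, P) (act h (d, Q) v) = act h (d, P + Q) v"
  unfolding act_def fst_conv snd_conv by (rule shear_shear) (simp add: poly_map_poly_hom)

lemma act_0: "comm_ring_hom h \<Longrightarrow> act h (d, 0) v = v"
  unfolding act_def fst_conv snd_conv by (rule shear_0) (simp add: poly_map_poly_hom)

lemma act_hom:
  assumes "comm_ring_hom h" "comm_ring_hom k"
  shows "map_prod k k (act h x v) = act (\<lambda>a. k (h a)) x (map_prod k k v)"
  by (simp add: act_def shear_def Let_def dir_hom_def poly_map_poly_hom[OF assms(1)] assms(2)
    comm_ring_hom_simps[OF assms(2)] map_prod_def case_prod_unfold)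

lemma run_hom:
  assumes "comm_ring_hom h" "comm_ring_hom k"
  shows "map_prod k k (run h w v) = run (\<lambda>a. k (h a)) w (map_prod k k v)"
  by (induction w) (simp_all add: act_hom[OF assms])

section \<open>Words as automorphisms and as matrices\<close>

definition word_aut :: "('a::comm_ring_1 option \<times> 'a poly) list \<Rightarrow> 'a poly poly \<times> 'a poly poly" where
  "word_aut w = run const2 w (X2, Y2)"

lemma comp2_map_prod: "comp2 F G = map_prod (subst2 G) (subst2 G) F"
  by (simp add: comp2_def map_prod_def case_prod_unfold)

lemma comp2_run: "comp2 (run const2 w F) G = run const2 w (comp2 F G)"
  by (simp add: comp2_map_prod run_hom[OF const2_hom subst2_hom])

lemma comp2_one: "comp2 (X2, Y2) F = F" "comp2 F (X2, Y2) = F"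
  by (simp_all add: comp2_def subst2_id)

lemma comp2_word_aut: "comp2 (word_aut w) G = run const2 w G"
  by (simp add: word_aut_def comp2_run comp2_one)

lemma word_aut_append: "word_aut (w @ w') = comp2 (word_aut w) (word_aut w')"
  by (simp add: comp2_word_aut) (simp add: word_aut_def)

text \<open>The matrix 1 + P w \<lambda> with column w = (-b, a) and row \<lambda> = (a, b), where
  (a, b) is the direction of the letter.\<close>

definition shear_mat :: "'a::comm_ring_1 option \<times> 'a poly \<Rightarrow> 'a poly mat" where
  "shear_mat x = (case dir (fst x) of (a, b) \<Rightarrow>
     mat 2 2 (\<lambda>(i, j). of_bool (i = j) + (if i = 0 then - [:b:] else [:a:]) * (if j = 0 then [:a:] else [:b:]) * snd x))"

definition word_mat :: "('a::comm_ring_1 option \<times> 'a poly) list \<Rightarrow> 'a poly mat" where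
  "word_mat w = foldr (\<lambda>x M. shear_mat x * M) w (1\<^sub>m 2)"

lemma shear_mat_carrier [simp]: "shear_mat x \<in> carrier_mat 2 2"
  by (simp add: shear_mat_def split: prod.split)

lemma word_mat_simps [simp]: "word_mat [] = 1\<^sub>m 2" "word_mat (x # w) = shear_mat x * word_mat w"
  by (simp_all add: word_mat_def)

lemma word_mat_carrier [simp]: "word_mat w \<in> carrier_mat 2 2"
  by (induction w) (auto intro!: mult_carrier_mat[OF shear_mat_carrier])

lemma word_mat_append: "word_mat (w @ w') = word_mat w * word_mat w'"
  by (induction w) (auto simp: assoc_mult_mat[OF shear_mat_carrier word_mat_carrier word_mat_carrier]
    left_mult_one_mat[OF word_mat_carrier])

definition vec2 :: "'b \<times> 'b \<Rightarrow> 'b vec" where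
  "vec2 v = vec 2 (\<lambda>i. if i = 0 then fst v else snd v)"

lemma vec2_carrier [simp]: "vec2 v \<in> carrier_vec 2"
  by (simp add: vec2_def)

lemma vec2_inject: "vec2 v = vec2 v' \<longleftrightarrow> v = v'"
proof
  assume "vec2 v = vec2 v'"
  then have "vec2 v $ 0 = vec2 v' $ 0" "vec2 v $ 1 = vec2 v' $ 1" by simp_all
  then show "v = v'" by (simp add: vec2_def prod_eq_iff)
qed simp

lemma shear_mat_mult_vec:
  "shear_mat (d, P) *\<^sub>v vec2 v = vec2 (shear (dir_hom (\<lambda>c. [:c:]) d) (\<lambda>q. P * q) v)"
proof -
  have two: "{0..<2} = {0, 1 :: nat}" by auto
  obtain a b where ab: "dir d = (a, b)" by fastforce
  show ?thesis
  proof (rule eq_vecI)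
    fix i assume "i < dim_vec (vec2 (shear (dir_hom (\<lambda>c. [:c:]) d) (\<lambda>q. P * q) v))"
    then have "i = 0 \<or> i = 1" by (auto simp: vec2_def)
    then show "(shear_mat (d, P) *\<^sub>v vec2 v) $ i = vec2 (shear (dir_hom (\<lambda>c. [:c:]) d) (\<lambda>q. P * q) v) $ i"
      by (auto simp: shear_mat_def ab vec2_def scalar_prod_def two shear_def dir_hom_def Let_def
        smult_add_right algebra_simps)
  qed (auto simp: shear_mat_def vec2_def ab)
qed

lemma shear_mat_mult: "shear_mat (d, P) * shear_mat (d, Q) = shear_mat (d, P + Q)"
proof -
  have two: "{0..<2} = {0, 1 :: nat}" by auto
  obtain a b where ab: "dir d = (a, b)" by fastforce
  show ?thesis
  proof (rule eq_matI)
    fix i j assume "i < dim_row (shear_mat (d, P + Q))" "j < dim_col (shear_mat (d, P + Q))"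
    then have "i = 0 \<or> i = 1" "j = 0 \<or> j = 1" by (auto simp: shear_mat_def ab)
    then show "(shear_mat (d, P) * shear_mat (d, Q)) $$ (i, j) = shear_mat (d, P + Q) $$ (i, j)"
      by (auto simp: shear_mat_def ab scalar_prod_def two algebra_simps)
  qed (auto simp: shear_mat_def ab)
qed

lemma shear_mat_0: "shear_mat (d, 0) = 1\<^sub>m 2"
  by (rule eq_matI) (auto simp: shear_mat_def split: prod.split)

section \<open>Reduced words with letters from x^2 K[x]\<close>

definition no_affine_part :: "'a::zero poly \<Rightarrow> bool" where
  "no_affine_part P \<longleftrightarrow> coeff P 0 = 0 \<and> coeff P 1 = 0"

definition valid_word :: "('a::zero option \<times> 'a poly) list \<Rightarrow> bool" where
  "valid_word w \<longleftrightarrow> (\<forall>x\<in>set w. no_affine_part (snd x))"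

definition reduced_word :: "('a::zero option \<times> 'a poly) list \<Rightarrow> bool" where
  "reduced_word w \<longleftrightarrow> valid_word w \<and> (\<forall>x\<in>set w. snd x \<noteq> 0) \<and> successively (\<lambda>x y. fst x \<noteq> fst y) w"

text \<open>Adjacent letters of equal direction are merged and letters with P = 0 dropped.
  Automorphisms and matrices obey the same two rules, so one reduced word serves both.\<close>

lemma reduce_word:
  assumes "valid_word (w :: ('a::comm_ring_1 option \<times> 'a poly) list)"
  shows "\<exists>w'. reduced_word w' \<and> word_aut w' = word_aut w \<and> word_mat w' = word_mat w"
  using assms
proof (induction w)
  case Nil
  show ?case by (rule exI[of _ "[]"]) (simp add: reduced_word_def valid_word_def)
next
  case (Cons x w)
  obtain d P where x: "x = (d, P)" by fastforce
  obtain w' where w': "reduced_word w'" "word_aut w' = word_aut w" "word_mat w' = word_mat w"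
    using Cons by (auto simp: valid_word_def)
  have eq: "word_aut (x # w) = act const2 x (word_aut w')" "word_mat (x # w) = shear_mat x * word_mat w'"
    using w' by (simp_all add: word_aut_def)
  have P: "no_affine_part P" using Cons.prems by (simp add: valid_word_def x)
  show ?case
  proof (cases "P = 0")
    case True
    then show ?thesis using w' eq
      by (intro exI[of _ w'])
        (simp add: x act_0[OF const2_hom] shear_mat_0 left_mult_one_mat[OF word_mat_carrier])
  next
    case False
    show ?thesis
    proof (cases "w' = [] \<or> fst (hd w') \<noteq> d")
      case True
      then have "reduced_word (x # w')" using w'(1) P False
        by (cases w') (auto simp: reduced_word_def valid_word_def x)
      then show ?thesis using eq by (intro exI[of _ "x # w'"]) (simp add: word_aut_def)
    next
      case False
      then obtain Q w'' where w'': "w' = (d, Q) # w''" by (cases w') auto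
      have red: "reduced_word w''"
        using w'(1) by (auto simp: reduced_word_def valid_word_def w'' successively_Cons)
      have eq': "word_aut (x # w) = act const2 (d, P + Q) (word_aut w'')"
        "word_mat (x # w) = shear_mat (d, P + Q) * word_mat w''"
        unfolding eq by (simp_all add: x w'' word_aut_def act_act[OF const2_hom] shear_mat_mult
          assoc_mult_mat[OF shear_mat_carrier shear_mat_carrier word_mat_carrier, symmetric])
      show ?thesis
      \<comment> \<open>If the merged letter cancels, the remaining tail is already reduced.\<close>
      proof (cases "P + Q = 0")
        case True
        then show ?thesis using red eq'
          by (intro exI[of _ w'']) (simp add: act_0[OF const2_hom] shear_mat_0 left_mult_one_mat[OF word_mat_carrier])
      next
        case False
        have "reduced_word ((d, P + Q) # w'')"
          using w'(1) P False red
          by (auto simp: reduced_word_def valid_word_def w'' successively_Cons no_affine_part_def)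
        then show ?thesis using eq' by (intro exI[of _ "(d, P + Q) # w''"]) (simp add: word_aut_def)
      qed
    qed
  qed
qed

text \<open>The coefficient vector at D is a nonzero multiple of w = (-b, a) for the direction (a,
  b). D \<ge> 2 rules out the linear vectors from which the argument starts.\<close>

definition top_along :: "nat \<Rightarrow> 'a::comm_ring_1 option \<Rightarrow> 'a poly \<times> 'a poly \<Rightarrow> bool" where
  "top_along D d v \<longleftrightarrow> D \<ge> 2 \<and> degree (fst v) \<le> D \<and> degree (snd v) \<le> D \<and>
     (\<exists>c. c \<noteq> 0 \<and> coeff (fst v) D = - c * snd (dir d) \<and> coeff (snd v) D = c * fst (dir d))"

text \<open>Different directions are different projective points, so a form \<lambda> does not kill
  the vector w of another direction.\<close>

lemma dir_neq:
  "d \<noteq> e \<Longrightarrow> snd (dir d) * fst (dir e) \<noteq> fst (dir d) * (snd (dir e) :: 'a::field)"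
  by (cases d; cases e) auto

text \<open>If \<lambda> does not vanish on the coefficients at D, then \<lambda>(v) has degree D
  and A raises it to some E > D. The coefficients at E come from A(\<lambda>(v)) w alone.\<close>

lemma shear_top_along:
  fixes v :: "'a::field poly \<times> 'a poly"
  assumes A: "\<And>q. degree q > 0 \<Longrightarrow> degree (A q) > degree q"
    and D: "D > 0" "degree (fst v) \<le> D" "degree (snd v) \<le> D"
    and ne: "fst (dir d) * coeff (fst v) D + snd (dir d) * coeff (snd v) D \<noteq> 0"
  shows "\<exists>D. top_along D d (shear (dir_hom (\<lambda>c. [:c:]) d) A v)"
proof -
  obtain a b where ab: "dir d = (a, b)" by fastforce
  define q where "q = [:a:] * fst v + [:b:] * snd v"
  have "coeff q D \<noteq> 0" using ne by (simp add: q_def ab)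
  moreover have "degree q \<le> D" unfolding q_def using D
    by (intro degree_add_le) (auto intro: order_trans[OF degree_smult_le])
  ultimately have q: "degree q = D" using le_degree by (metis order_antisym)
  define E where "E = degree (A q)"
  have E: "E > D" using A[of q] q D by (simp add: E_def)
  then have c: "coeff (A q) E \<noteq> 0" unfolding E_def by auto
  have [simp]: "coeff (fst v) E = 0" "coeff (snd v) E = 0" using D E by (auto intro!: coeff_eq_0)
  have deg: "degree (A q) \<le> E" by (simp add: E_def)
  have "shear (dir_hom (\<lambda>c. [:c:]) d) A v = (fst v - [:b:] * A q, snd v + [:a:] * A q)"
    by (simp add: shear_def dir_hom_def ab q_def Let_def)
  moreover have "top_along E d (fst v - [:b:] * A q, snd v + [:a:] * A q)"
    unfolding top_along_def using D E c deg
    by (auto simp: ab intro!: degree_diff_le degree_add_le order_trans[OF degree_smult_le]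
      exI[of _ "coeff (A q) E"])
  ultimately show ?thesis by metis
qed

text \<open>A ping-pong argument: each letter turns the leading coefficients along its own w, on
  which the form of the next letter does not vanish, so the degree keeps growing.\<close>

lemma foldr_shear_nontrivial:
  fixes w :: "('a::field option \<times> 'c) list"
  assumes "w \<noteq> []" "successively (\<lambda>x y. fst x \<noteq> fst y) w"
    and "\<And>x q. x \<in> set w \<Longrightarrow> degree q > 0 \<Longrightarrow> degree (A (snd x) q) > degree q"
  defines "step \<equiv> \<lambda>x. shear (dir_hom (\<lambda>c. [:c:]) (fst x)) (A (snd x))"
  shows "\<exists>v. foldr step w v \<noteq> v"
proof -
  \<comment> \<open>The rightmost letter, which acts first, decides between (t, 0) and (0, t): its
    form must not vanish there.\<close>
  have "\<exists>v\<in>{([:0, 1:], 0), (0, [:0, 1:])}. \<exists>D. top_along D (fst (hd w)) (foldr step w v)"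
    using assms(1-3)
  proof (induction w rule: induct_list012)
    case (2 x)
    then have A: "\<And>q. degree q > 0 \<Longrightarrow> degree (A (snd x) q) > degree q" by simp
    show ?case
    proof (cases "fst (dir (fst x)) = 0")
      case False
      then have "\<exists>D. top_along D (fst x) (step x ([:0, 1:], 0))"
        unfolding step_def by (intro shear_top_along[where D = 1] A) auto
      then show ?thesis by auto
    next
      case True
      then have "snd (dir (fst x)) \<noteq> 0" by (cases "fst x") auto
      then have "\<exists>D. top_along D (fst x) (step x (0, [:0, 1:]))"
        unfolding step_def by (intro shear_top_along[where D = 1] A) auto
      then show ?thesis by auto
    qed
  next
    case (3 x y zs)
    then obtain v D where v: "v \<in> {([:0, 1:], 0), (0, [:0, 1:])}"
        and D: "top_along D (fst y) (foldr step (y # zs) v)"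
      by fastforce
    define u where "u = foldr step (y # zs) v"
    obtain c where c: "c \<noteq> 0" "coeff (fst u) D = - c * snd (dir (fst y))"
      "coeff (snd u) D = c * fst (dir (fst y))"
      using D unfolding top_along_def u_def by blast
    have "fst x \<noteq> fst y" using 3 by simp
    then have "c * (snd (dir (fst x)) * fst (dir (fst y)) - fst (dir (fst x)) * snd (dir (fst y))) \<noteq> 0"
      using c dir_neq by auto
    then have "\<exists>D. top_along D (fst x) (step x u)"
      unfolding step_def using D[folded u_def] 3(5)
      by (intro shear_top_along[where D = D]) (auto simp: c top_along_def algebra_simps)
    with v show ?case unfolding u_def by auto
  qed simp
  then obtain v D where v: "v \<in> {([:0, 1:], 0), (0, [:0, 1 :: 'a:])}"
      and D: "top_along D (fst (hd w)) (foldr step w v)" by blast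
  have "foldr step w v \<noteq> v"
  proof
    assume "foldr step w v = v"
    with D have t: "top_along D (fst (hd w)) v" by simp
    then have "D \<ge> 2" by (simp add: top_along_def)
    then have "coeff (fst v) D = 0" "coeff (snd v) D = 0" using v by (auto simp: coeff_eq_0)
    with t show False by (cases "fst (hd w)") (auto simp: top_along_def)
  qed
  then show ?thesis ..
qed

lemma no_affine_part_degree: "no_affine_part P \<Longrightarrow> P \<noteq> 0 \<Longrightarrow> degree P \<ge> 2"
  unfolding no_affine_part_def by (metis One_nat_def leading_coeff_0_iff less_2_cases not_less)

text \<open>The word is evaluated at a pair of polynomials in one variable, where its letters act by
  composition with P, of degree at least 2.\<close>

lemma reduced_word_aut:
  fixes w :: "('a::field option \<times> 'a poly) list"
  assumes "reduced_word w" "w \<noteq> []"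
  shows "word_aut w \<noteq> (X2, Y2)"
proof
  assume eq: "word_aut w = (X2, Y2)"
  let ?A = "\<lambda>P. poly (map_poly (\<lambda>c. [:c:]) P)"
  have A: "degree (?A (snd x) q) > degree q" if "x \<in> set w" "degree q > 0" for x and q :: "'a poly"
  proof -
    have "degree (snd x) \<ge> 2" using assms that by (auto simp: reduced_word_def valid_word_def no_affine_part_degree)
    moreover have "?A (snd x) q = pcompose (snd x) q" by (simp add: pcompose_altdef)
    ultimately show ?thesis using that(2) by (simp add: degree_pcompose)
  qed
  obtain v where v: "foldr (\<lambda>x. shear (dir_hom (\<lambda>c. [:c:]) (fst x)) (?A (snd x))) w v \<noteq> v"
    using foldr_shear_nontrivial[of w ?A] assms A by (auto simp: reduced_word_def)
  let ?e = "eval2 (\<lambda>c. [:c:]) (fst v) (snd v)"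
  note hom = eval2_simps[OF const_poly_hom]
  have "map_prod ?e ?e (word_aut w) = run (\<lambda>c. [:c:]) w v"
    unfolding word_aut_def by (simp add: run_hom[OF const2_hom eval2_hom[OF const_poly_hom]] hom)
  moreover have "map_prod ?e ?e (word_aut w) = v" by (simp add: eq hom)
  ultimately show False using v by (simp add: run_def act_def[abs_def])
qed

lemma word_mat_mult_vec:
  "word_mat w *\<^sub>v vec2 v = vec2 (foldr (\<lambda>x. shear (dir_hom (\<lambda>c. [:c:]) (fst x)) ((*) (snd x))) w v)"
proof (induction w)
  case (Cons x w)
  then show ?case
    using shear_mat_mult_vec[of "fst x" "snd x"]
    by (simp add: assoc_mult_mat_vec[OF shear_mat_carrier word_mat_carrier vec2_carrier])
qed (simp add: one_mult_mat_vec[OF vec2_carrier])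

text \<open>Here the letters act on vectors through multiplication by P, which raises degrees as
  well.\<close>

lemma reduced_word_mat:
  fixes w :: "('a::field option \<times> 'a poly) list"
  assumes "reduced_word w" "w \<noteq> []"
  shows "word_mat w \<noteq> 1\<^sub>m 2"
proof
  assume eq: "word_mat w = 1\<^sub>m 2"
  have A: "degree (snd x * q) > degree q" if "x \<in> set w" "degree q > 0" for x and q :: "'a poly"
  proof -
    have "snd x \<noteq> 0" "degree (snd x) \<ge> 2"
      using assms that by (auto simp: reduced_word_def valid_word_def no_affine_part_degree)
    moreover have "q \<noteq> 0" using that by auto
    ultimately show ?thesis by (simp add: degree_mult_eq)
  qed
  obtain v where "foldr (\<lambda>x. shear (dir_hom (\<lambda>c. [:c:]) (fst x)) ((*) (snd x))) w v \<noteq> v"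
    using foldr_shear_nontrivial[of w "(*)"] assms A by (auto simp: reduced_word_def)
  then show False using word_mat_mult_vec[of w v]
    by (simp add: eq one_mult_mat_vec[OF vec2_carrier] vec2_inject)
qed

text \<open>Either the reduced form is empty and both sides hold, or it is not and both
  fail.\<close>

lemma word_aut_trivial_iff:
  fixes w :: "('a::field option \<times> 'a poly) list"
  assumes "valid_word w"
  shows "word_aut w = (X2, Y2) \<longleftrightarrow> word_mat w = 1\<^sub>m 2"
proof -
  obtain w' where w': "reduced_word w'" "word_aut w' = word_aut w" "word_mat w' = word_mat w"
    using reduce_word[OF assms] by blast
  show ?thesis
  proof (cases "w' = []")
    case True
    then show ?thesis using w' by (simp add: word_aut_def[of "[]"])
  next
    case False
    then show ?thesis using reduced_word_aut[OF w'(1)] reduced_word_mat[OF w'(1)] w' by simp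
  qed
qed

section \<open>Inverse words\<close>

definition word_inv :: "('a::comm_ring_1 option \<times> 'a poly) list \<Rightarrow> ('a option \<times> 'a poly) list" where
  "word_inv w = rev (map (\<lambda>(d, P). (d, - P)) w)"

lemma valid_word_inv: "valid_word w \<Longrightarrow> valid_word (word_inv w)"
  by (auto simp: valid_word_def word_inv_def no_affine_part_def)

lemma valid_word_append: "valid_word (w @ w') \<longleftrightarrow> valid_word w \<and> valid_word w'"
  by (auto simp: valid_word_def)

lemma word_inv_word_inv: "word_inv (word_inv w) = w"
  by (simp add: word_inv_def rev_map comp_def case_prod_unfold)

lemma run_word_inv: "comm_ring_hom h \<Longrightarrow> run h (word_inv w) (run h w v) = v"
proof (induction w arbitrary: v)
  case (Cons x w)
  obtain d P where x: "x = (d, P)" by fastforce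
  have "word_inv (x # w) = word_inv w @ [(d, - P)]" by (simp add: word_inv_def x)
  with Cons show ?case by (simp add: x act_act act_0)
qed (simp add: word_inv_def)

lemma word_aut_inv: "comp2 (word_aut (word_inv w)) (word_aut w) = (X2, Y2)"
    "comp2 (word_aut w) (word_aut (word_inv w)) = (X2, Y2)"
  using run_word_inv[OF const2_hom, of w] run_word_inv[OF const2_hom, of "word_inv w"]
  by (simp_all add: comp2_word_aut word_inv_word_inv) (simp_all add: word_aut_def)

lemma word_mat_inv: "word_mat (word_inv w) * word_mat w = 1\<^sub>m 2"
proof (induction w)
  case (Cons x w)
  obtain d P where x: "x = (d, P)" by fastforce
  have "word_inv (x # w) = word_inv w @ [(d, - P)]" by (simp add: word_inv_def x)
  then have "word_mat (word_inv (x # w)) * word_mat (x # w) =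
      word_mat (word_inv w) * shear_mat (d, - P) * (shear_mat (d, P) * word_mat w)"
    by (simp add: word_mat_append x right_mult_one_mat[OF shear_mat_carrier])
  also have "\<dots> = word_mat (word_inv w) * (shear_mat (d, - P) * shear_mat (d, P) * word_mat w)"
    using assoc_mult_mat[OF word_mat_carrier[of "word_inv w"] shear_mat_carrier[of "(d, - P)"]
       mult_carrier_mat[OF shear_mat_carrier[of "(d, P)"] word_mat_carrier[of w]]]
      assoc_mult_mat[OF shear_mat_carrier[of "(d, - P)"] shear_mat_carrier[of "(d, P)"] word_mat_carrier[of w]]
    by simp
  also have "\<dots> = 1\<^sub>m 2"
    by (simp add: shear_mat_mult shear_mat_0 left_mult_one_mat[OF word_mat_carrier] Cons)
  finally show ?case .
qed (simp add: word_inv_def)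

text \<open>The criterion for triviality is applied to w^-1 w'. It makes the matrix a well-defined
  and injective function of the automorphism.\<close>

lemma word_aut_eq_iff:
  fixes w w' :: "('a::field option \<times> 'a poly) list"
  assumes "valid_word w" "valid_word w'"
  shows "word_aut w = word_aut w' \<longleftrightarrow> word_mat w = word_mat w'"
proof -
  have v: "valid_word (word_inv w @ w')" using assms by (simp add: valid_word_append valid_word_inv)
  have "word_aut w = word_aut w' \<longleftrightarrow> word_aut (word_inv w @ w') = (X2, Y2)"
  proof
    assume "word_aut (word_inv w @ w') = (X2, Y2)"
    then have "run const2 (word_inv w) (word_aut w') = (X2, Y2)" by (simp add: word_aut_def)
    then have "run const2 w (run const2 (word_inv w) (word_aut w')) = word_aut w" by (simp add: word_aut_def)
    then show "word_aut w = word_aut w'"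
      using run_word_inv[OF const2_hom, of "word_inv w"] by (simp add: word_inv_word_inv)
  next
    assume "word_aut w = word_aut w'"
    then show "word_aut (word_inv w @ w') = (X2, Y2)"
      using word_aut_inv(1)[of w] by (simp add: word_aut_append)
  qed
  also have "\<dots> \<longleftrightarrow> word_mat (word_inv w @ w') = 1\<^sub>m 2" by (rule word_aut_trivial_iff[OF v])
  also have "\<dots> \<longleftrightarrow> word_mat w = word_mat w'"
  proof
    assume "word_mat (word_inv w @ w') = 1\<^sub>m 2"
    then have "word_mat w * (word_mat (word_inv w) * word_mat w') = word_mat w * 1\<^sub>m 2"
      by (simp add: word_mat_append)
    then have "word_mat w * word_mat (word_inv w) * word_mat w' = word_mat w"
      by (simp add: assoc_mult_mat[OF word_mat_carrier word_mat_carrier word_mat_carrier]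
        right_mult_one_mat[OF word_mat_carrier])
    moreover have "word_mat w * word_mat (word_inv w) = 1\<^sub>m 2"
      using word_mat_inv[of "word_inv w"] by (simp add: word_inv_word_inv)
    ultimately show "word_mat w = word_mat w'" by (simp add: left_mult_one_mat[OF word_mat_carrier])
  next
    assume "word_mat w = word_mat w'"
    then show "word_mat (word_inv w @ w') = 1\<^sub>m 2" using word_mat_inv[of w] by (simp add: word_mat_append)
  qed
  finally show ?thesis .
qed

section \<open>The theorem of Jung and van der Kulk\<close>

text \<open>(a, b, c) encodes a x + b y + c; pairs that are not invertible are included.\<close>

definition affine_pair :: "('a \<times> 'a \<times> 'a) \<times> ('a \<times> 'a \<times> 'a) \<Rightarrow> 'a::comm_ring_1 poly poly \<times> 'a poly poly" where
  "affine_pair = map_prod (\<lambda>(a, b, c). [:[:c, a:], [:b:]:]) (\<lambda>(a, b, c). [:[:c, a:], [:b:]:])"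

definition words_affine :: "('a::comm_ring_1 poly poly \<times> 'a poly poly) set" where
  "words_affine = {run const2 w F | w F. valid_word w \<and> F \<in> range affine_pair}"

text \<open>The form (a, b) is not restricted to the representatives in \<open>dir\<close>, since
  conjugation by a linear map leads away from them.\<close>

definition shear_gen :: "'a::comm_ring_1 \<Rightarrow> 'a \<Rightarrow> 'a poly \<Rightarrow> 'a poly poly \<times> 'a poly poly \<Rightarrow> 'a poly poly \<times> 'a poly poly" where
  "shear_gen a b P = shear (const2 a, const2 b) (poly (map_poly const2 P))"

definition lin :: "'a::comm_ring_1 \<Rightarrow> 'a \<Rightarrow> 'a \<Rightarrow> 'a \<Rightarrow> 'a poly poly \<times> 'a poly poly \<Rightarrow> 'a poly poly \<times> 'a poly poly" where
  "lin p q r s v = (const2 p * fst v + const2 q * snd v, const2 r * fst v + const2 s * snd v)"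

lemma const2_arith:
  "const2 (a * b) = const2 a * const2 b" "const2 (a - b) = const2 a - const2 b"
  "const2 (a + b) = const2 a + const2 b" "const2 (- a) = - const2 a" "const2 0 = 0" "const2 1 = 1"
  by (simp_all add: one_pCons)

lemma poly_map_poly_rescale:
  assumes "comm_ring_hom h"
  shows "poly (map_poly h (pcompose P [:0, c:])) x = poly (map_poly h P) (h c * x)"
proof -
  interpret comm_ring_hom h by fact
  interpret m: map_poly_comm_ring_hom h ..
  show ?thesis
    by (induction P) (simp_all add: pcompose_pCons map_poly_pCons hom_distribs algebra_simps)
qed

lemma no_affine_part_rescale:
  fixes P :: "'a::{comm_ring_1, semiring_no_zero_divisors} poly"
  shows "no_affine_part P \<Longrightarrow> no_affine_part (Polynomial.smult a (pcompose P [:0, c:]))"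
  by (simp add: no_affine_part_def coeff_pcompose_linear poly_0_coeff_0)

text \<open>If (a, b) = c (a', b'), then \<lambda> and w both scale by c, which is absorbed by
  replacing P(x) with c P(c x).\<close>

lemma shear_gen_normalise:
  fixes a b :: "'a::field"
  assumes "a \<noteq> 0 \<or> b \<noteq> 0" "no_affine_part P"
  shows "\<exists>x. no_affine_part (snd x) \<and> shear_gen a b P = act const2 x"
proof -
  have *: "\<exists>x. no_affine_part (snd x) \<and> shear_gen a b P = act const2 x"
    if d: "dir d = (a', b')" "a = c * a'" "b = c * b'" for d a' b' c
  proof -
    define Q where "Q = Polynomial.smult c (pcompose P [:0, c:])"
    have Q: "poly (map_poly const2 Q) x = const2 c * poly (map_poly const2 P) (const2 c * x)" for x
    proof -
      have "Q = [:c:] * pcompose P [:0, c:]" by (simp add: Q_def)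
      then show ?thesis
        using comm_ring_hom_simps(3)[OF map_poly_hom_aux[OF const2_hom, of x], of "[:c:]" "pcompose P [:0, c:]"]
        by (cases "c = 0") (simp_all add: poly_map_poly_rescale[OF const2_hom] map_poly_pCons)
    qed
    have "shear_gen a b P v = act const2 (d, Q) v" for v
      by (simp only: shear_gen_def act_def shear_def Let_def dir_hom_def d map_prod_simp fst_conv snd_conv
        Q const2_arith) (simp add: algebra_simps)
    moreover have "no_affine_part Q" unfolding Q_def by (rule no_affine_part_rescale) fact
    ultimately show ?thesis by (intro exI[of _ "(d, Q)"]) auto
  qed
  show ?thesis
  proof (cases "a = 0")
    case True
    then show ?thesis using assms *[of None 0 1 b] by simp
  next
    case False
    then show ?thesis using *[of "Some (b / a)" 1 "b / a" a] by simp
  qed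
qed

text \<open>For a matrix M of determinant \<delta>, the form \<lambda> adj(M) has the value \<delta>
  \<lambda>(v) at M v, and its kernel vector is M w. Dividing the argument of P by \<delta>
  compensates.\<close>

lemma lin_shear_gen:
  fixes p q r s :: "'a::field"
  assumes det: "p * s - q * r \<noteq> 0"
  shows "lin p q r s (shear_gen a b P v) =
    shear_gen (a * s - b * r) (b * p - a * q) (pcompose P [:0, inverse (p * s - q * r):]) (lin p q r s v)"
proof -
  let ?d = "p * s - q * r"
  have "const2 (inverse ?d) * (const2 (a * s - b * r) * fst (lin p q r s v) + const2 (b * p - a * q) * snd (lin p q r s v))
      = const2 (inverse ?d * ?d) * (const2 a * fst v + const2 b * snd v)"
    unfolding lin_def fst_conv snd_conv const2_arith by (simp only: algebra_simps)
  also have "\<dots> = const2 a * fst v + const2 b * snd v"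
    by (simp only: left_inverse[OF det] const2_arith(6) mult_1)
  finally have e: "poly (map_poly const2 (pcompose P [:0, inverse ?d:]))
      (const2 (a * s - b * r) * fst (lin p q r s v) + const2 (b * p - a * q) * snd (lin p q r s v)) =
      poly (map_poly const2 P) (const2 a * fst v + const2 b * snd v)"
    by (simp only: poly_map_poly_rescale[OF const2_hom])
  show ?thesis
    unfolding shear_gen_def shear_def Let_def fst_conv snd_conv e
    unfolding lin_def fst_conv snd_conv const2_arith by (simp only: algebra_simps)
qed

lemma act_eq_shear_gen: "act const2 (d, P) = shear_gen (fst (dir d)) (snd (dir d)) P"
  by (simp add: act_def shear_gen_def dir_hom_def map_prod_def case_prod_unfold)

text \<open>Invertible linear maps conjugate shears to shears, so they move past a word letter by
  letter.\<close>

lemma lin_run: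
  fixes p q r s :: "'a::field"
  assumes det: "p * s - q * r \<noteq> 0" and "valid_word w"
  shows "\<exists>w'. valid_word w' \<and> lin p q r s (run const2 w v) = run const2 w' (lin p q r s v)"
  using assms(2)
proof (induction w)
  case (Cons x w)
  then obtain w' where w': "valid_word w'" "lin p q r s (run const2 w v) = run const2 w' (lin p q r s v)"
    by (auto simp: valid_word_def)
  obtain d P where x: "x = (d, P)" by fastforce
  obtain a b where ab: "dir d = (a, b)" by fastforce
  then have ab0: "a \<noteq> 0 \<or> b \<noteq> 0" by (cases d) auto
  \<comment> \<open>The new form is nonzero: a and b times the determinant are combinations of its
    entries.\<close>
  have "a * s - b * r \<noteq> 0 \<or> b * p - a * q \<noteq> 0"
  proof (rule ccontr)
    assume "\<not> ?thesis"
    then have 0: "a * s - b * r = 0" "b * p - a * q = 0" by auto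
    have "a * (p * s - q * r) = p * (a * s - b * r) + r * (b * p - a * q)"
      "b * (p * s - q * r) = q * (a * s - b * r) + s * (b * p - a * q)"
      by (simp_all add: algebra_simps)
    then show False using 0 det ab0 by auto
  qed
  moreover have "no_affine_part (pcompose P [:0, inverse (p * s - q * r):])"
    using no_affine_part_rescale[of P 1] Cons.prems by (simp add: x valid_word_def)
  ultimately obtain y where y: "no_affine_part (snd y)"
    "shear_gen (a * s - b * r) (b * p - a * q) (pcompose P [:0, inverse (p * s - q * r):]) = act const2 y"
    using shear_gen_normalise by blast
  have "lin p q r s (run const2 (x # w) v) = act const2 y (run const2 w' (lin p q r s v))"
    by (simp only: run_simps x act_eq_shear_gen ab fst_conv snd_conv lin_shear_gen[OF det] y w')
  with w' y show ?case by (intro exI[of _ "y # w'"]) (simp add: valid_word_def)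
qed (auto simp: valid_word_def intro!: exI[of _ "[]"])

lemma lin_affine: "lin p q r s (affine_pair x) \<in> range affine_pair"
proof -
  obtain a b c a' b' c' where x: "x = ((a, b, c), (a', b', c'))" by (cases x) auto
  show ?thesis
    by (rule range_eqI[of _ _ "((p * a + q * a', p * b + q * b', p * c + q * c'),
       (r * a + s * a', r * b + s * b', r * c + s * c'))"])
      (simp add: lin_def affine_pair_def x)
qed

lemma words_affine_lin:
  fixes p q r s :: "'a::field"
  assumes "p * s - q * r \<noteq> 0" "F \<in> words_affine"
  shows "lin p q r s F \<in> words_affine"
  using assms lin_run[OF assms(1)] lin_affine unfolding words_affine_def by blast

lemma words_affine_shear_gen:
  fixes a b :: "'a::field"
  assumes "a \<noteq> 0 \<or> b \<noteq> 0" "no_affine_part P" "F \<in> words_affine"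
  shows "shear_gen a b P F \<in> words_affine"
proof -
  obtain x where x: "no_affine_part (snd x)" "shear_gen a b P = act const2 x"
    using shear_gen_normalise[OF assms(1,2)] by blast
  obtain w A where "F = run const2 w A" "valid_word w" "A \<in> range affine_pair"
    using assms(3) by (auto simp: words_affine_def)
  then show ?thesis unfolding words_affine_def x(2)
    by (intro CollectI exI[of _ "x # w"] exI[of _ A]) (auto simp: x valid_word_def)
qed

lemma words_affine_swap: "(g, f) \<in> words_affine \<Longrightarrow> (f, g) \<in> (words_affine :: ('a::field poly poly \<times> _) set)"
  using words_affine_lin[of 0 0 1 1 "(g, f)"] by (simp add: lin_def one_pCons[symmetric])

section \<open>Automorphisms as invertible pairs\<close>

definition aut_pair :: "'a::comm_ring_1 poly poly \<times> 'a poly poly \<Rightarrow> bool" where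
  "aut_pair F \<longleftrightarrow> (\<exists>G. comp2 F G = (X2, Y2) \<and> comp2 G F = (X2, Y2))"

lemma comp2_assoc: "comp2 (comp2 F G) H = comp2 F (comp2 G H)"
  by (simp add: comp2_def subst2_subst2)

lemma aut_pair_comp2:
  assumes "aut_pair F" "aut_pair G" shows "aut_pair (comp2 F G)"
proof -
  obtain F' G' where "comp2 F F' = (X2, Y2)" "comp2 F' F = (X2, Y2)"
     "comp2 G G' = (X2, Y2)" "comp2 G' G = (X2, Y2)"
    using assms by (auto simp: aut_pair_def)
  then have "comp2 (comp2 F G) (comp2 G' F') = (X2, Y2)" "comp2 (comp2 G' F') (comp2 F G) = (X2, Y2)"
    by (metis comp2_assoc comp2_one(1))+
  then show ?thesis unfolding aut_pair_def by blast
qed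

lemma subst2_arith:
  "subst2 F (a - b) = subst2 F a - subst2 F b" "subst2 F (a + b) = subst2 F a + subst2 F b"
  "subst2 F (a * b) = subst2 F a * subst2 F b" "subst2 F (a ^ n) = subst2 F a ^ n"
  by (rule comm_ring_hom_simps[OF subst2_hom])+

lemma aut_pair_swap: "aut_pair (f, g) \<Longrightarrow> aut_pair (g, f)"
proof -
  assume *: "aut_pair (f, g)"
  have "comp2 (Y2, X2) (Y2, X2) = (X2, Y2)" by (simp only: comp2_def fst_conv snd_conv subst2_X2 subst2_Y2)
  then have "aut_pair (Y2, X2)" by (auto simp: aut_pair_def)
  from aut_pair_comp2[OF this *] show ?thesis by (simp only: comp2_def fst_conv snd_conv subst2_X2 subst2_Y2)
qed

text \<open>Composition with (x - c y^k, y), whose inverse is (x + c y^k, y).\<close>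

lemma aut_pair_elementary:
  assumes "aut_pair (f, g)"
  shows "aut_pair (f - const2 c * g ^ k, g)"
proof -
  have "comp2 (X2 - const2 c * Y2 ^ k, Y2) (X2 + const2 c * Y2 ^ k, Y2) = (X2, Y2)"
    "comp2 (X2 + const2 c * Y2 ^ k, Y2) (X2 - const2 c * Y2 ^ k, Y2) = (X2, Y2)"
    by (simp_all only: comp2_def fst_conv snd_conv subst2_X2 subst2_Y2 subst2_arith subst2_const2
      add_diff_cancel_right' diff_add_cancel)
  then have "aut_pair (X2 - const2 c * Y2 ^ k, Y2)" by (auto simp: aut_pair_def)
  from aut_pair_comp2[OF this assms] show ?thesis
    by (simp only: comp2_def fst_conv snd_conv subst2_X2 subst2_Y2 subst2_arith subst2_const2)
qed

lemma subst2_const_poly: "subst2 (F, G) [:f:] = poly (map_poly const2 f) F"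
  by (cases "f = 0") (simp_all add: subst2_def map_poly_pCons)

lemma poly_map_const2: "poly (map_poly const2 f) F = pcompose (map_poly (\<lambda>c. [:c:]) f) F"
  unfolding pcompose_altdef by (subst map_poly_map_poly) (simp_all add: comp_def)

lemma poly_map_const2_const: "poly (map_poly const2 f) [:u:] = [:pcompose f u:]"
  using poly_map_poly_hom(3)[OF const_poly_hom const_poly_hom, of f u] by (simp add: pcompose_altdef)

lemma degree_1_cases:
  assumes "degree p = 1" obtains a b where "p = [:b, a:]" "a \<noteq> 0"
proof
  show "p = [:coeff p 0, lead_coeff p:]"
    using assms by (intro poly_eqI) (auto simp: coeff_pCons coeff_eq_0 split: nat.splits)
  show "lead_coeff p \<noteq> 0" using assms by (metis degree_0 leading_coeff_0_iff zero_neq_one)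
qed

text \<open>Here f lies in K[x]. From f(F, G) = x also F lies in K[x], and degrees force f to have
  degree 1. Then G(f, g) = y forces g to have y-degree 1 with a unit as leading coefficient.\<close>

lemma aut_pair_triangular:
  fixes f g :: "'a::field poly poly"
  assumes "aut_pair (f, g)" "degree f = 0"
  obtains a b c g0 where "a \<noteq> 0" "f = [:[:b, a:]:]" "g = [:g0, [:c:]:]"
proof -
  obtain F G where inv: "subst2 (F, G) f = X2" "subst2 (f, g) F = X2" "subst2 (f, g) G = Y2"
    using assms(1) by (auto simp: aut_pair_def comp2_def)
  obtain f0 where f0: "f = [:f0:]" using assms(2) by (metis degree_0_id)
  have e: "pcompose (map_poly (\<lambda>c. [:c:]) f0) F = X2"
    using inv(1) by (simp add: f0 subst2_const_poly poly_map_const2)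
  have "degree f0 * degree F = degree (pcompose (map_poly (\<lambda>c. [:c:]) f0) F)"
    by (simp add: degree_pcompose degree_map_poly)
  then have "degree f0 * degree F = 0" by (simp add: e)
  moreover have "degree f0 \<noteq> 0"
  proof
    assume "degree f0 = 0"
    then obtain k where "f0 = [:k:]" by (metis degree_0_id)
    then have "subst2 (F, G) f = const2 k" by (simp only: f0 subst2_const2)
    then show False using inv(1) by simp
  qed
  ultimately have "degree F = 0" by simp
  then obtain F0 where F0: "F = [:F0:]" by (metis degree_0_id)
  have "pcompose f0 F0 = [:0, 1:]"
    using inv(1) by (simp add: f0 F0 subst2_const_poly poly_map_const2_const)
  then have "degree f0 * degree F0 = 1" by (metis degree_pcompose degree_pCons_eq_if one_neq_zero degree_0 pCons_eq_0_iff One_nat_def)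
  then have "degree f0 = 1" by simp
  then obtain a b where ab: "f0 = [:b, a:]" "a \<noteq> 0" by (metis degree_1_cases)
  \<comment> \<open>Substituting f for x in the coefficients of G makes G(f, g) a composition in the
    variable y alone.\<close>
  define G' where "G' = map_poly (\<lambda>c. pcompose c f0) G"
  have pc: "pcompose G' g = Y2"
    using inv(3) unfolding G'_def pcompose_altdef subst2_def fst_conv snd_conv f0 poly_map_const2_const
    by (subst map_poly_map_poly) (simp_all add: comp_def)
  then have "degree G' * degree g = 1" by (metis degree_pcompose degree_pCons_eq_if one_neq_zero degree_0 pCons_eq_0_iff One_nat_def)
  then have "degree G' = 1" "degree g = 1" by simp_all
  then obtain u v g0 g1 where uv: "G' = [:u, v:]" "g = [:g0, g1:]" by (metis degree_1_cases)
  have "coeff (pcompose G' g) 1 = 1" by (simp add: pc)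
  then have "v * g1 = 1" by (simp add: uv pcompose_pCons mult.commute)
  then have "g1 dvd 1" by (metis dvd_triv_right)
  then obtain c where "g1 = [:c:]" by (metis is_unit_poly_iff)
  with that ab uv f0 show ?thesis by blast
qed

text \<open>With g0 = Q0(a x + b), the part of Q0 of degree at most 1 goes into an affine pair, and
  the rest is added by the shear with form (1, 0).\<close>

lemma words_affine_triangular:
  fixes g0 :: "'a::field poly"
  assumes "a \<noteq> 0"
  shows "([:[:b, a:]:], [:g0, [:c:]:]) \<in> words_affine"
proof -
  define Q0 where "Q0 = pcompose g0 [:- b / a, inverse a:]"
  have "pcompose Q0 [:b, a:] = pcompose g0 (pcompose [:- b / a, inverse a:] [:b, a:])"
    unfolding Q0_def by (rule pcompose_assoc[symmetric])
  also have "pcompose [:- b / a, inverse a:] [:b, a:] = [:0, 1:]"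
  proof -
    have "inverse a * b - b / a = 0" "inverse a * a = 1"
      using assms by (simp_all add: divide_inverse mult.commute)
    then show ?thesis by (simp add: pcompose_pCons)
  qed
  finally have Q0: "pcompose Q0 [:b, a:] = g0" by simp
  define L where "L = [:coeff Q0 0, coeff Q0 1:]"
  define Q where "Q = Q0 - L"
  have Q: "no_affine_part Q" by (simp add: no_affine_part_def Q_def L_def)
  have "affine_pair ((a, 0, b), (coeff Q0 1 * a, c, coeff Q0 0 + coeff Q0 1 * b)) =
      ([:[:b, a:]:], [:pcompose L [:b, a:], [:c:]:])"
    by (simp add: affine_pair_def L_def pcompose_pCons)
  then have "([:[:b, a:]:], [:pcompose L [:b, a:], [:c:]:]) \<in> range affine_pair"
    by (metis rangeI)
  moreover have "valid_word []" by (simp add: valid_word_def)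
  moreover have "run const2 [] v = v" for v :: "'a poly poly \<times> 'a poly poly" by simp
  ultimately have "([:[:b, a:]:], [:pcompose L [:b, a:], [:c:]:]) \<in> words_affine"
    unfolding words_affine_def by (metis (mono_tags, lifting) mem_Collect_eq)
  then have "shear_gen 1 0 Q ([:[:b, a:]:], [:pcompose L [:b, a:], [:c:]:]) \<in> words_affine"
    by (rule words_affine_shear_gen[rotated 2]) (use Q in auto)
  also have "shear_gen 1 0 Q ([:[:b, a:]:], [:pcompose L [:b, a:], [:c:]:]) =
      ([:[:b, a:]:], [:pcompose L [:b, a:] + pcompose Q [:b, a:], [:c:]:])"
    by (simp add: shear_gen_def shear_def poly_map_const2_const one_pCons[symmetric] Let_def)
  also have "pcompose L [:b, a:] + pcompose Q [:b, a:] = g0"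
    using Q0 by (simp add: Q_def pcompose_diff)
  finally show ?thesis .
qed

text \<open>Elementary maps lower the sum of the y-degrees until one of them is 0 and the pair is
  triangular.\<close>

theorem aut_pair_words_affine:
  fixes f g :: "'a::field poly poly"
  assumes "aut_pair (f, g)"
  shows "(f, g) \<in> words_affine"
  using assms
proof (induction "degree f + degree g" arbitrary: f g rule: less_induct)
  case less
  have reduce: "(f', g') \<in> words_affine"
    if aut: "aut_pair (f', g')" and sum: "degree f' + degree g' = degree f + degree g"
      and pos: "degree f' > 0" "degree g' > 0" and k: "k > 0" "degree f' = k * degree g'"
      and lc: "lead_coeff f' = Polynomial.smult c (lead_coeff g' ^ k)" for f' g' :: "'a poly poly" and c k
  proof -
    define h where "h = f' - const2 c * g' ^ k"
    \<comment> \<open>Both terms of h have degree at most deg f', and their coefficients there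
      cancel.\<close>
    have "degree h < degree f'"
    proof -
      have "degree (const2 c * g' ^ k) \<le> degree f'"
        using k degree_power_le[of g' k] by (auto intro: order_trans[OF degree_smult_le] simp: mult.commute)
      then have "degree h \<le> degree f'" unfolding h_def by (intro degree_diff_le) auto
      moreover have "coeff h (degree f') = 0"
        using k lc coeff_power_bound[of g' "degree g'" k] by (simp add: h_def)
      ultimately show ?thesis using pos
        by (metis degree_0 leading_coeff_0_iff order_le_less)
    qed
    then have "(h, g') \<in> words_affine"
      using less.hyps[of h g'] sum aut_pair_elementary[OF aut] by (simp add: h_def)
    moreover have "f' = h + const2 c * g' ^ k" by (simp add: h_def)
    ultimately show ?thesis
    proof (cases "k = 1")
      case True
      assume "(h, g') \<in> words_affine" "f' = h + const2 c * g' ^ k"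
      then show ?thesis using words_affine_lin[of 1 1 c 0 "(h, g')"] True
        by (simp add: lin_def one_pCons[symmetric])
    next
      case False
      assume "(h, g') \<in> words_affine" and f': "f' = h + const2 c * g' ^ k"
      \<comment> \<open>For k \<ge> 2 the elementary map is a shear. The sign compensates w = (-1,
        0), which belongs to the form (0, 1).\<close>
      moreover have "no_affine_part (monom (- c) k)" using False k by (simp add: no_affine_part_def)
      ultimately have "shear_gen 0 1 (monom (- c) k) (h, g') \<in> words_affine"
        by (intro words_affine_shear_gen) auto
      also have "shear_gen 0 1 (monom (- c) k) (h, g') = (f', g')"
        unfolding f' using smult_minus_left[of "[:c:]"] by (simp add: shear_gen_def shear_def one_pCons[symmetric] map_poly_monom poly_monom Let_def)
      finally show ?thesis .
    qed
  qed
  consider "degree f = 0" | "degree g = 0" | "degree f > 0" "degree g > 0" by auto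
  then show ?case
  proof cases
    case 1
    then show ?thesis using aut_pair_triangular[OF less.prems] words_affine_triangular by metis
  next
    case 2
    then show ?thesis using aut_pair_triangular[OF aut_pair_swap[OF less.prems]] words_affine_triangular
        words_affine_swap by metis
  next
    case 3
    obtain F G where inv: "comp2 (f, g) (F, G) = (X2, Y2)" "comp2 (F, G) (f, g) = (X2, Y2)"
      using less.prems by (auto simp: aut_pair_def)
    then have "eval2 const2 f g F = X2" "eval2 const2 f g G = Y2"
      "eval2 const2 F G f = X2" "eval2 const2 F G g = Y2"
      by (simp_all add: comp2_def subst2_eval2)
    from this 3 show ?thesis
    proof (cases rule: aut_degree_dvd)
      case (1 c k)
      then show ?thesis using reduce[OF less.prems refl 3] by blast
    next
      case (2 c k)
      then have "(g, f) \<in> words_affine"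
        using reduce[OF aut_pair_swap[OF less.prems] add.commute 3(2,1)] by blast
      then show ?thesis by (rule words_affine_swap)
    qed
  qed
qed

section \<open>Induced representations\<close>

text \<open>From g^-1 = h a follows g = a^-1 h^-1, so the inverses of A meet every left coset; one
  representative is then chosen in each.\<close>

lemma (in group) finite_left_transversal:
  assumes H: "subgroup H G" and A: "finite A" "A \<subseteq> carrier G"
    and cover: "\<And>g. g \<in> carrier G \<Longrightarrow> \<exists>h\<in>H. \<exists>a\<in>A. g = h \<otimes> a"
  obtains R where "finite R" "R \<subseteq> carrier G" "R \<noteq> {}"
    "\<forall>g\<in>carrier G. \<exists>!r. r \<in> R \<and> inv r \<otimes> g \<in> H"
proof
  interpret H: subgroup H G by fact
  define B where "B = (\<lambda>a. inv a) ` A"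
  have B: "finite B" "B \<subseteq> carrier G" using A by (auto simp: B_def)
  have coverB: "\<exists>b\<in>B. inv b \<otimes> g \<in> H" if g: "g \<in> carrier G" for g
  proof -
    obtain h a where ha: "h \<in> H" "a \<in> A" "inv g = h \<otimes> a" using cover[of "inv g"] g by auto
    then have c: "h \<in> carrier G" "a \<in> carrier G" using A H.subset by auto
    have "a = inv h \<otimes> inv g" using ha(3) c g by (simp add: m_assoc[symmetric])
    then have "inv (inv a) \<otimes> g = inv h" using c g by (simp add: m_assoc)
    then show ?thesis using ha H.m_inv_closed unfolding B_def by (metis imageI)
  qed
  define rep where "rep g = (SOME b. b \<in> B \<and> inv b \<otimes> g \<in> H)" for g
  have rep: "rep g \<in> B" "inv (rep g) \<otimes> g \<in> H" if "g \<in> carrier G" for g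
    using someI_ex[of "\<lambda>b. b \<in> B \<and> inv b \<otimes> g \<in> H"] coverB[OF that] unfolding rep_def by blast+
  have shift: "inv b \<otimes> g' \<in> H"
    if "inv g \<otimes> g' \<in> H" "inv b \<otimes> g \<in> H" "b \<in> carrier G" "g \<in> carrier G" "g' \<in> carrier G" for b g g'
  proof -
    have "inv b \<otimes> g' = (inv b \<otimes> g) \<otimes> (inv g \<otimes> g')"
      using that(3-5) by (simp add: m_assoc[symmetric]) (simp add: m_assoc)
    then show ?thesis using that H.m_closed by simp
  qed
  have flip: "inv g' \<otimes> g \<in> H" if "inv g \<otimes> g' \<in> H" "g \<in> carrier G" "g' \<in> carrier G" for g g'
    using H.m_inv_closed[OF that(1)] that by (simp add: inv_mult_group)
  \<comment> \<open>Elements of one coset satisfy the same predicate, so the choice operator returns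
    the same representative.\<close>
  have rep_eq: "rep g = rep g'" if "inv g \<otimes> g' \<in> H" "g \<in> carrier G" "g' \<in> carrier G" for g g'
  proof -
    have "(b \<in> B \<and> inv b \<otimes> g \<in> H) = (b \<in> B \<and> inv b \<otimes> g' \<in> H)" for b
      using shift that flip B by blast
    then show ?thesis unfolding rep_def by simp
  qed
  define R where "R = rep ` carrier G"
  show "finite R" "R \<subseteq> carrier G" "R \<noteq> {}"
    using rep B by (auto simp: R_def intro: finite_subset)
  show "\<forall>g\<in>carrier G. \<exists>!r. r \<in> R \<and> inv r \<otimes> g \<in> H"
  proof
    fix g assume g: "g \<in> carrier G"
    show "\<exists>!r. r \<in> R \<and> inv r \<otimes> g \<in> H"
    proof (rule ex1I[of _ "rep g"])
      show "rep g \<in> R \<and> inv (rep g) \<otimes> g \<in> H" using rep g by (auto simp: R_def)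
      fix r assume r: "r \<in> R \<and> inv r \<otimes> g \<in> H"
      then obtain g' where g': "g' \<in> carrier G" "r = rep g'" by (auto simp: R_def)
      then have rc: "r \<in> carrier G" using rep B by auto
      then have "rep r = rep g'" using rep[OF g'(1)] g' rep_eq by metis
      then show "r = rep g" using rep_eq[of r g] r rc g g' by simp
    qed
  qed
qed

section \<open>Block matrices\<close>

lemma sum_div_mod_split:
  fixes f :: "nat \<Rightarrow> 'b::comm_monoid_add"
  assumes "d > 0"
  shows "(\<Sum>k<N * d. f k) = (\<Sum>i<N. \<Sum>a<d. f (i * d + a))"
proof (induction N)
  case (Suc N)
  have "(\<Sum>k<Suc N * d. f k) = (\<Sum>k<N * d. f k) + (\<Sum>k\<in>{N * d..<Suc N * d}. f k)"
    by (subst sum.union_disjoint[symmetric]) (auto intro!: sum.cong)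
  also have "(\<Sum>k\<in>{N * d..<Suc N * d}. f k) = (\<Sum>a<d. f (N * d + a))"
    by (rule sum.reindex_bij_witness[of _ "\<lambda>a. N * d + a" "\<lambda>k. k - N * d"]) auto
  finally show ?case using Suc by simp
qed simp

lemma block_index_less: "i < N \<Longrightarrow> a < d \<Longrightarrow> i * d + a < N * (d :: nat)"
proof -
  assume "i < N" "a < d"
  then have "i * d + a < Suc i * d" "Suc i * d \<le> N * d" by (simp_all only: mult_le_mono1 Suc_leI) simp
  then show ?thesis by linarith
qed

definition block_mat :: "nat \<Rightarrow> nat \<Rightarrow> (nat \<Rightarrow> nat \<Rightarrow> 'a mat) \<Rightarrow> 'a mat" where
  "block_mat N d B = mat (N * d) (N * d) (\<lambda>(i, j). B (i div d) (j div d) $$ (i mod d, j mod d))"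

lemma block_mat_carrier [simp]: "block_mat N d B \<in> carrier_mat (N * d) (N * d)"
  by (simp add: block_mat_def)

lemma block_mat_index:
  assumes "i < N" "j < N" "a < d" "b < d"
  shows "block_mat N d B $$ (i * d + a, j * d + b) = B i j $$ (a, b)"
proof -
  have "i * d + a < N * d" "j * d + b < N * d"
    using assms by (simp_all add: block_index_less)
  then show ?thesis using assms by (simp add: block_mat_def)
qed

lemma block_mat_eqI:
  assumes "M \<in> carrier_mat (N * d) (N * d)" "d > 0"
    and "\<And>i j a b. i < N \<Longrightarrow> j < N \<Longrightarrow> a < d \<Longrightarrow> b < d \<Longrightarrow> M $$ (i * d + a, j * d + b) = B i j $$ (a, b)"
  shows "M = block_mat N d B"
proof (rule eq_matI)
  fix i j assume "i < dim_row (block_mat N d B)" "j < dim_col (block_mat N d B)"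
  then have ij: "i < N * d" "j < N * d" by (simp_all add: block_mat_def)
  then have "i div d < N" "j div d < N" by (simp_all add: less_mult_imp_div_less)
  then show "M $$ (i, j) = block_mat N d B $$ (i, j)"
    using assms(3)[of "i div d" "j div d" "i mod d" "j mod d"] assms(2) ij by (simp add: block_mat_def)
qed (use assms in \<open>auto simp: block_mat_def\<close>)

text \<open>As for monomial matrices, each block sum has at most one nonzero term.\<close>

lemma block_mat_mult:
  fixes B C :: "nat \<Rightarrow> nat \<Rightarrow> 'a::comm_ring_1 mat"
  assumes d: "d > 0"
    and B: "\<And>i j. i < N \<Longrightarrow> j < N \<Longrightarrow> B i j \<in> carrier_mat d d"
    and C: "\<And>i j. i < N \<Longrightarrow> j < N \<Longrightarrow> C i j \<in> carrier_mat d d"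
    and D: "\<And>i j. i < N \<Longrightarrow> j < N \<Longrightarrow> \<exists>k<N. D i j = B i k * C k j \<and> (\<forall>l<N. l \<noteq> k \<longrightarrow> B i l * C l j = 0\<^sub>m d d)"
  shows "block_mat N d B * block_mat N d C = block_mat N d D"
proof (rule block_mat_eqI[OF _ d])
  fix i j a b assume ij: "i < N" "j < N" and ab: "a < d" "b < d"
  have lt: "i * d + a < N * d" "j * d + b < N * d"
    using ij ab by (simp_all add: block_index_less)
  have prod: "(B i l * C l j) $$ (a, b) = (\<Sum>c<d. B i l $$ (a, c) * C l j $$ (c, b))" if "l < N" for l
    using B[OF ij(1) that] C[OF that ij(2)] ab
    by (simp add: scalar_prod_def lessThan_atLeast0)
  have "(block_mat N d B * block_mat N d C) $$ (i * d + a, j * d + b) =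
      (\<Sum>k<N * d. block_mat N d B $$ (i * d + a, k) * block_mat N d C $$ (k, j * d + b))"
    using lt by (simp add: scalar_prod_def lessThan_atLeast0 block_mat_def)
  also have "\<dots> = (\<Sum>l<N. \<Sum>c<d. B i l $$ (a, c) * C l j $$ (c, b))"
    unfolding sum_div_mod_split[OF d] using ij ab by (intro sum.cong) (simp_all add: block_mat_index)
  also have "\<dots> = (\<Sum>l<N. (B i l * C l j) $$ (a, b))" by (intro sum.cong) (simp_all add: prod)
  also obtain k where k: "k < N" "D i j = B i k * C k j" "\<And>l. l < N \<Longrightarrow> l \<noteq> k \<Longrightarrow> B i l * C l j = 0\<^sub>m d d"
    using D[OF ij] by blast
  have "(\<Sum>l<N. (B i l * C l j) $$ (a, b)) = (\<Sum>l<N. if l = k then D i j $$ (a, b) else 0)"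
    using k ab by (intro sum.cong) auto
  also have "\<dots> = D i j $$ (a, b)" using k by simp
  finally show "(block_mat N d B * block_mat N d C) $$ (i * d + a, j * d + b) = D i j $$ (a, b)" .
qed (simp add: mult_carrier_mat[OF block_mat_carrier block_mat_carrier])

lemma GL_I:
  fixes M :: "'k::field mat"
  assumes "M \<in> carrier_mat n n" "M' \<in> carrier_mat n n" "M * M' = 1\<^sub>m n" "M' * M = 1\<^sub>m n"
  shows "M \<in> carrier (GL n)"
  using assms unfolding GL_def units_of_def Units_def by (auto simp: ring_mat_def)

text \<open>The induced representation: with a transversal \<open>r\<close> of the left cosets of \<open>H\<close>, the \<open>(i, j)\<close> block
  of the image of \<open>g\<close> is \<open>\<rho> (r\<^sub>i\<^sup>-\<^sup>1 g r\<^sub>j)\<close>, read as 0 off \<open>H\<close>.\<close>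
lemma (in group) linear_of_finite_index_linear:
  fixes \<rho> :: "'a \<Rightarrow> 'k::field mat"
  assumes H: "subgroup H G" and A: "finite A" "A \<subseteq> carrier G"
    and cover: "\<And>g. g \<in> carrier G \<Longrightarrow> \<exists>h\<in>H. \<exists>a\<in>A. g = h \<otimes> a"
    and d: "d > 0"
    and \<rho>: "\<And>h. h \<in> H \<Longrightarrow> \<rho> h \<in> carrier_mat d d" "\<rho> \<one> = 1\<^sub>m d"
      "\<And>h k. h \<in> H \<Longrightarrow> k \<in> H \<Longrightarrow> \<rho> (h \<otimes> k) = \<rho> h * \<rho> k"
      "\<And>h. h \<in> H \<Longrightarrow> \<rho> h = 1\<^sub>m d \<Longrightarrow> h = \<one>"
  shows "\<exists>n\<ge>1. \<exists>\<phi>. group_hom G (GL n :: 'k mat monoid) \<phi> \<and> inj_on \<phi> (carrier G)"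
proof -
  interpret H: subgroup H G by fact
  obtain R where R: "finite R" "R \<subseteq> carrier G" "R \<noteq> {}"
    and R1: "\<forall>g\<in>carrier G. \<exists>!r. r \<in> R \<and> inv r \<otimes> g \<in> H"
    by (rule finite_left_transversal[OF H A cover])
  define N where "N = card R"
  have N: "N > 0" using R by (auto simp: N_def card_gt_0_iff)
  obtain r where r: "bij_betw r {0..<N} R" using ex_bij_betw_nat_finite[OF R(1)] by (auto simp: N_def)
  have rc [simp]: "r i \<in> carrier G" if "i < N" for i
    using bij_betwE[OF r] R(2) that by (simp add: subsetD)
  have r1: "\<exists>k<N. inv (r k) \<otimes> g \<in> H \<and> (\<forall>l<N. l \<noteq> k \<longrightarrow> inv (r l) \<otimes> g \<notin> H)" if g: "g \<in> carrier G" for g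
  proof -
    obtain x where x: "x \<in> R" "inv x \<otimes> g \<in> H" "\<And>y. y \<in> R \<Longrightarrow> inv y \<otimes> g \<in> H \<Longrightarrow> y = x"
      using bspec[OF R1 g] by (elim ex1E) blast
    then obtain k where k: "k < N" "r k = x" using bij_betw_imp_surj_on[OF r] by force
    have "l = k" if l: "l < N" "inv (r l) \<otimes> g \<in> H" for l
    proof -
      have "r l \<in> R" using bij_betwE[OF r] l(1) by simp
      then have "r l = r k" using x(3) l(2) k(2) by simp
      then show ?thesis using bij_betw_imp_inj_on[OF r] l(1) k(1) by (simp add: inj_on_eq_iff)
    qed
    then show ?thesis using k x by blast
  qed
  define \<rho>0 where "\<rho>0 h = (if h \<in> H then \<rho> h else 0\<^sub>m d d)" for h
  have \<rho>0 [simp]: "\<rho>0 h \<in> carrier_mat d d" for h using \<rho>(1) by (simp add: \<rho>0_def)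
  define \<phi> where "\<phi> g = block_mat N d (\<lambda>i j. \<rho>0 (inv (r i) \<otimes> g \<otimes> r j))" for g
  have \<phi>_mult: "\<phi> (g \<otimes> g') = \<phi> g * \<phi> g'" if g: "g \<in> carrier G" "g' \<in> carrier G" for g g'
    unfolding \<phi>_def
  proof (rule block_mat_mult[OF d, symmetric])
    fix i j assume ij: "i < N" "j < N"
    \<comment> \<open>The coset of g' r_j has index k, the only one whose right factor can be
      nonzero.\<close>
    obtain k where k: "k < N" "inv (r k) \<otimes> (g' \<otimes> r j) \<in> H"
      "\<And>l. l < N \<Longrightarrow> l \<noteq> k \<Longrightarrow> inv (r l) \<otimes> (g' \<otimes> r j) \<notin> H"
      using r1[of "g' \<otimes> r j"] m_closed[OF g(2) rc[OF ij(2)]] by blast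
    have eq: "inv (r i) \<otimes> (g \<otimes> g') \<otimes> r j = (inv (r i) \<otimes> g \<otimes> r k) \<otimes> (inv (r k) \<otimes> g' \<otimes> r j)"
    proof -
      have "(inv (r i) \<otimes> g \<otimes> r k) \<otimes> (inv (r k) \<otimes> g' \<otimes> r j) =
          inv (r i) \<otimes> g \<otimes> (r k \<otimes> inv (r k)) \<otimes> g' \<otimes> r j"
        using g ij k by (simp only: m_assoc m_closed inv_closed rc)
      then show ?thesis using g ij k by (simp add: m_assoc)
    qed
    have kH: "inv (r k) \<otimes> g' \<otimes> r j \<in> H" using k(2) g ij k(1) by (simp add: m_assoc)
    have "\<rho>0 (inv (r i) \<otimes> (g \<otimes> g') \<otimes> r j) = \<rho>0 (inv (r i) \<otimes> g \<otimes> r k) * \<rho>0 (inv (r k) \<otimes> g' \<otimes> r j)"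
    proof (cases "inv (r i) \<otimes> g \<otimes> r k \<in> H")
      case True
      then show ?thesis using kH \<rho>(3) eq H.m_closed by (simp add: \<rho>0_def)
    next
      case False
      \<comment> \<open>The right factor lies in H, so the product lies in H only if the left factor
        does.\<close>
      have "inv (r i) \<otimes> (g \<otimes> g') \<otimes> r j \<notin> H"
      proof
        define x y where "x = inv (r i) \<otimes> g \<otimes> r k" and "y = inv (r k) \<otimes> g' \<otimes> r j"
        have xy: "x \<in> carrier G" "y \<in> H" using g ij k(1) kH by (simp_all add: x_def y_def)
        assume "inv (r i) \<otimes> (g \<otimes> g') \<otimes> r j \<in> H"
        then have "x \<otimes> y \<in> H" unfolding eq x_def y_def .
        from H.m_closed[OF this H.m_inv_closed[OF xy(2)]] have "x \<in> H"
          using xy H.subset by (simp add: m_assoc subsetD)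
        then show False using False by (simp add: x_def)
      qed
      then show ?thesis using False left_mult_zero_mat[OF \<rho>0] by (simp add: \<rho>0_def)
    qed
    moreover have "\<rho>0 (inv (r i) \<otimes> g \<otimes> r l) * \<rho>0 (inv (r l) \<otimes> g' \<otimes> r j) = 0\<^sub>m d d" if "l < N" "l \<noteq> k" for l
    proof -
      have "inv (r l) \<otimes> g' \<otimes> r j \<notin> H" using k(3)[OF that] g ij that by (simp add: m_assoc)
      then show ?thesis using right_mult_zero_mat[OF \<rho>0] by (simp add: \<rho>0_def)
    qed
    ultimately show "\<exists>k<N. \<rho>0 (inv (r i) \<otimes> (g \<otimes> g') \<otimes> r j) =
        \<rho>0 (inv (r i) \<otimes> g \<otimes> r k) * \<rho>0 (inv (r k) \<otimes> g' \<otimes> r j) \<and>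
        (\<forall>l<N. l \<noteq> k \<longrightarrow> \<rho>0 (inv (r i) \<otimes> g \<otimes> r l) * \<rho>0 (inv (r l) \<otimes> g' \<otimes> r j) = 0\<^sub>m d d)"
      using k(1) by blast
  qed simp_all
  have \<phi>_one: "\<phi> \<one> = 1\<^sub>m (N * d)"
    unfolding \<phi>_def
  proof (rule block_mat_eqI[symmetric, OF _ d])
    fix i j a b assume ij: "i < N" "j < N" and ab: "a < d" "b < d"
    have lt: "i * d + a < N * d" "j * d + b < N * d"
      using ij ab by (simp_all add: block_index_less)
    have "(i * d + a = j * d + b) = (i = j \<and> a = b)"
    proof
      assume e: "i * d + a = j * d + b"
      then have "(i * d + a) div d = (j * d + b) div d" "(i * d + a) mod d = (j * d + b) mod d" by simp_all
      then show "i = j \<and> a = b" using ab by simp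
    qed simp
    \<comment> \<open>Distinct representatives lie in distinct cosets, so only diagonal blocks
      survive at the identity.\<close>
    moreover have "inv (r i) \<otimes> r j \<in> H \<longleftrightarrow> i = j"
    proof -
      obtain k where k: "\<forall>l<N. l \<noteq> k \<longrightarrow> inv (r l) \<otimes> r j \<notin> H" using r1[OF rc[OF ij(2)]] by blast
      have jj: "inv (r j) \<otimes> r j \<in> H" using ij by simp
      then have "j = k" using k ij by blast
      then show ?thesis using k jj ij by blast
    qed
    ultimately show "1\<^sub>m (N * d) $$ (i * d + a, j * d + b) = \<rho>0 (inv (r i) \<otimes> \<one> \<otimes> r j) $$ (a, b)"
      using ij ab lt \<rho>(2) by (auto simp: \<rho>0_def)
  qed simp
  have \<phi>_GL: "\<phi> g \<in> carrier (GL (N * d))" if g: "g \<in> carrier G" for g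
  proof (rule GL_I)
    show "\<phi> g * \<phi> (inv g) = 1\<^sub>m (N * d)" "\<phi> (inv g) * \<phi> g = 1\<^sub>m (N * d)"
      using g \<phi>_mult[of g "inv g"] \<phi>_mult[of "inv g" g] by (simp_all add: \<phi>_one)
  qed (simp_all add: \<phi>_def)
  have hom: "group_hom G (GL (N * d) :: 'k mat monoid) \<phi>"
  proof (intro group_hom.intro group_hom_axioms.intro group_GL is_group homI)
    fix g g' assume "g \<in> carrier G" "g' \<in> carrier G"
    then show "\<phi> (g \<otimes> g') = \<phi> g \<otimes>\<^bsub>GL (N * d)\<^esub> \<phi> g'"
      using \<phi>_mult by (simp add: GL_def units_of_def ring_mat_def)
  qed (rule \<phi>_GL)
  have \<phi>_inj: "g = \<one>" if g: "g \<in> carrier G" and 1: "\<phi> g = \<phi> \<one>" for g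
  proof -
    \<comment> \<open>The block (0, 0) suffices: being the identity, it puts a conjugate of g into
      the kernel of \<rho> on H.\<close>
    have blk: "\<rho>0 (inv (r 0) \<otimes> g \<otimes> r 0) $$ (a, b) = 1\<^sub>m d $$ (a, b)" if "a < d" "b < d" for a b
    proof -
      have "\<phi> g $$ (0 * d + a, 0 * d + b) = \<phi> \<one> $$ (0 * d + a, 0 * d + b)" by (simp only: 1)
      then have "\<rho>0 (inv (r 0) \<otimes> g \<otimes> r 0) $$ (a, b) = \<rho>0 (inv (r 0) \<otimes> \<one> \<otimes> r 0) $$ (a, b)"
        unfolding \<phi>_def block_mat_index[OF N N that] .
      then show ?thesis using N \<rho>(2) by (simp add: \<rho>0_def)
    qed
    have eq1: "\<rho>0 (inv (r 0) \<otimes> g \<otimes> r 0) = 1\<^sub>m d"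
      using blk carrier_matD[OF \<rho>0[of "inv (r 0) \<otimes> g \<otimes> r 0"]] by (intro eq_matI) simp_all
    then have in_H: "inv (r 0) \<otimes> g \<otimes> r 0 \<in> H"
    proof (rule_tac ccontr)
      assume "inv (r 0) \<otimes> g \<otimes> r 0 \<notin> H"
      then have "0\<^sub>m d d $$ (0, 0) = (1\<^sub>m d $$ (0, 0) :: 'k)" using eq1 by (simp add: \<rho>0_def)
      then show False using d by simp
    qed
    then have "inv (r 0) \<otimes> g \<otimes> r 0 = \<one>" using \<rho>(4) eq1 by (simp add: \<rho>0_def)
    then have "r 0 \<otimes> (inv (r 0) \<otimes> g \<otimes> r 0) \<otimes> inv (r 0) = \<one>" using N by simp
    moreover have "r 0 \<otimes> (inv (r 0) \<otimes> g \<otimes> r 0) \<otimes> inv (r 0) = (r 0 \<otimes> inv (r 0)) \<otimes> g \<otimes> (r 0 \<otimes> inv (r 0))"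
      using N g by (simp only: m_assoc m_closed inv_closed rc)
    ultimately show ?thesis using N g by simp
  qed
  have "inj_on \<phi> (carrier G)"
  proof (rule inj_onI)
    fix g g' assume g: "g \<in> carrier G" "g' \<in> carrier G" "\<phi> g = \<phi> g'"
    then have "\<phi> (inv g \<otimes> g') = \<phi> (inv g \<otimes> g)" by (simp only: \<phi>_mult inv_closed)
    then have "inv g \<otimes> g' = \<one>" using g by (simp add: \<phi>_inj)
    then have "g \<otimes> (inv g \<otimes> g') = g" using g by simp
    then show "g = g'" using g by (simp add: m_assoc[symmetric])
  qed
  moreover have "N * d \<ge> 1" using N d by simp
  ultimately show ?thesis using hom by blast
qed

section \<open>The representation of the automorphism group\<close>

lemma Aut_A2_simps:
  "carrier Aut_A2 = {F. aut_pair F}" "mult Aut_A2 = comp2" "one Aut_A2 = (X2, Y2)"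
proof -
  show "carrier Aut_A2 = {F. aut_pair F}"
    unfolding Aut_A2_def units_of_def Units_def End_A2_def aut_pair_def by (simp add: conj_commute)
qed (simp_all add: Aut_A2_def units_of_def End_A2_def)

lemma aut_pair_word_aut: "aut_pair (word_aut w)"
  unfolding aut_pair_def using word_aut_inv by blast

definition word_group :: "('a::comm_ring_1 poly poly \<times> 'a poly poly) set" where
  "word_group = word_aut ` {w. valid_word w}"

lemma subgroup_word_group:
  "subgroup word_group (Aut_A2 :: ('a::comm_ring_1 poly poly \<times> 'a poly poly) monoid)"
proof (rule group.subgroupI[OF group_Aut_A2])
  show "word_group \<subseteq> carrier (Aut_A2 :: ('a poly poly \<times> 'a poly poly) monoid)"
    using aut_pair_word_aut unfolding word_group_def Aut_A2_simps by blast
  have "valid_word ([] :: ('a option \<times> 'a poly) list)" by (simp add: valid_word_def)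
  then show "(word_group :: ('a poly poly \<times> 'a poly poly) set) \<noteq> {}" unfolding word_group_def by blast
next
  fix F :: "'a poly poly \<times> 'a poly poly" assume "F \<in> word_group"
  then obtain w where w: "F = word_aut w" "valid_word w" by (auto simp: word_group_def)
  have "inv\<^bsub>Aut_A2\<^esub> F = word_aut (word_inv w)"
    unfolding w(1)
    by (rule group.inv_equality[OF group_Aut_A2])
       (simp_all only: Aut_A2_simps word_aut_inv(1) mem_Collect_eq aut_pair_word_aut)
  then show "inv\<^bsub>Aut_A2\<^esub> F \<in> word_group" using w valid_word_inv by (auto simp: word_group_def)
next
  fix F F' :: "'a poly poly \<times> 'a poly poly" assume "F \<in> word_group" "F' \<in> word_group"
  then obtain w w' where "F = word_aut w" "valid_word w" "F' = word_aut w'" "valid_word w'"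
    by (auto simp: word_group_def)
  then show "F \<otimes>\<^bsub>Aut_A2\<^esub> F' \<in> word_group"
    unfolding word_group_def Aut_A2_simps
    by (intro image_eqI[of _ _ "w @ w'"]) (simp_all only: mem_Collect_eq word_aut_append valid_word_append)
qed

text \<open>The affine factor is a quotient of two automorphisms and hence invertible
  itself.\<close>

lemma Aut_A2_word_group_affine:
  assumes "F \<in> carrier (Aut_A2 :: ('a::field poly poly \<times> 'a poly poly) monoid)"
  shows "\<exists>h\<in>word_group. \<exists>a\<in>range affine_pair \<inter> carrier Aut_A2. F = h \<otimes>\<^bsub>Aut_A2\<^esub> a"
proof -
  have F: "aut_pair F" using assms by (simp add: Aut_A2_simps)
  then have "F \<in> words_affine" using aut_pair_words_affine[of "fst F" "snd F"] by simp
  then obtain w A where w: "F = run const2 w A" "valid_word w" "A \<in> range affine_pair"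
    by (auto simp: words_affine_def)
  have "aut_pair (comp2 (word_aut (word_inv w)) F)" by (rule aut_pair_comp2[OF aut_pair_word_aut F])
  then have "aut_pair A" by (simp add: comp2_word_aut w(1) run_word_inv[OF const2_hom])
  then have "A \<in> range affine_pair \<inter> carrier Aut_A2" using w(3) by (simp only: Aut_A2_simps Int_iff mem_Collect_eq)
  moreover have "word_aut w \<in> word_group" using w(2) unfolding word_group_def by blast
  moreover have "F = word_aut w \<otimes>\<^bsub>Aut_A2\<^esub> A" by (simp only: w(1) Aut_A2_simps comp2_word_aut)
  ultimately show ?thesis by blast
qed

lemma Fract_inj_hom: "inj_comm_ring_hom (\<lambda>p :: 'a::idom. Fract p 1)"
  by unfold_locales (auto simp: Zero_fract_def One_fract_def eq_fract)

text \<open>Any word for F may be chosen: by \<open>word_aut_eq_iff\<close> the matrix depends on F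
  only.\<close>

definition word_rep :: "'a::field poly poly \<times> 'a poly poly \<Rightarrow> 'a poly fract mat" where
  "word_rep F = map_mat (\<lambda>p. Fract p 1) (word_mat (SOME w. valid_word w \<and> word_aut w = F))"

lemma word_rep_word_aut:
  assumes "valid_word w"
  shows "word_rep (word_aut w) = map_mat (\<lambda>p. Fract p 1) (word_mat w)"
proof -
  have "valid_word (SOME v. valid_word v \<and> word_aut v = word_aut w) \<and>
      word_aut (SOME v. valid_word v \<and> word_aut v = word_aut w) = word_aut w"
    by (rule someI[of _ w]) (simp add: assms)
  then have "word_mat (SOME v. valid_word v \<and> word_aut v = word_aut w) = word_mat w"
    using word_aut_eq_iff[OF _ assms] by blast
  then show ?thesis by (simp only: word_rep_def)
qed

theorem mainTheorem2:
  shows "\<exists>n\<ge>1. \<exists>\<phi>.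
    group_hom (Aut_A2 :: ('a::{field, finite} poly poly \<times> 'a poly poly) monoid)
      (GL n :: 'a poly fract mat monoid) \<phi> \<and>
    inj_on \<phi> (carrier Aut_A2)"
proof -
  interpret f: inj_comm_ring_hom "\<lambda>p :: 'a poly. Fract p 1" by (rule Fract_inj_hom)
  let ?G = "Aut_A2 :: ('a poly poly \<times> 'a poly poly) monoid"
  \<comment> \<open>The finiteness of K enters here: an affine pair has six coefficients in
    K.\<close>
  have "finite (range (affine_pair :: _ \<Rightarrow> 'a poly poly \<times> _))" by (rule finite_imageI) simp
  then have A: "finite (range affine_pair \<inter> carrier ?G)" by simp
  have nil: "valid_word []" "word_aut [] = \<one>\<^bsub>?G\<^esub>"
    by (simp_all add: valid_word_def word_aut_def Aut_A2_simps)
  show ?thesis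
  proof (rule group.linear_of_finite_index_linear[OF group_Aut_A2 subgroup_word_group A _
        Aut_A2_word_group_affine, where d = 2 and \<rho> = word_rep])
    fix h :: "'a poly poly \<times> 'a poly poly" assume "h \<in> word_group"
    then obtain w where w: "h = word_aut w" "valid_word w" by (auto simp: word_group_def)
    then show "word_rep h \<in> carrier_mat 2 2" by (simp add: word_rep_word_aut)
    show "h = \<one>\<^bsub>?G\<^esub>" if "word_rep h = 1\<^sub>m 2"
    proof -
      \<comment> \<open>K[t] embeds in K(t), so triviality of the matrix can be read off over
        K[t].\<close>
      have "map_mat (\<lambda>p. Fract p 1) (word_mat w) = map_mat (\<lambda>p. Fract p 1) (1\<^sub>m 2 :: 'a poly mat)"
        using that w by (simp add: word_rep_word_aut f.mat_hom_one)
      then have "word_mat w = 1\<^sub>m 2" by (rule f.mat_hom_inj)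
      then show ?thesis using w by (simp add: Aut_A2_simps word_aut_trivial_iff)
    qed
    fix k :: "'a poly poly \<times> 'a poly poly" assume "k \<in> word_group"
    then obtain v where v: "k = word_aut v" "valid_word v" by (auto simp: word_group_def)
    have "h \<otimes>\<^bsub>?G\<^esub> k = word_aut (w @ v)" by (simp add: Aut_A2_simps w v word_aut_append)
    then show "word_rep (h \<otimes>\<^bsub>?G\<^esub> k) = word_rep h * word_rep k"
      using w v f.mat_hom_mult[OF word_mat_carrier word_mat_carrier]
      by (simp add: word_rep_word_aut valid_word_append word_mat_append)
  next
    show "word_rep \<one>\<^bsub>?G\<^esub> = 1\<^sub>m 2"
      unfolding nil(2)[symmetric] word_rep_word_aut[OF nil(1)] by (simp add: f.mat_hom_one)
  qed auto
qed

end
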